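(* Let $L\colon[a,b]\times\mathbb{R}^n\times\mathbb{R}^n\to\mathbb{R}$ be continuous and satisfy the strict convexity condition (SC) stated in the context. Let $v\in W^{1,1}((a,b);\mathbb{R}^n)$ be a minimizer of $\mathscr{L}$ over $\mathscr{A}_{v(a),v(b)}$, and suppose that $t\in(a,b)$ is such that $D^-v(t)$ and $D^+v(t)$ both exist (with components finite or infinite). Then if at least one component of one of the one-sided derivatives $D^{-}v(t)$, $D^{+}v(t)$ is infinite, then at least one component of the other one-sided derivative is infinite.
   Context: $[a,b]\subseteq\mathbb{R}$, $n\ge1$, $\|\cdot\|$ is the Euclidean norm on $\mathbb{R}^n$. Functions in $W^{1,1}((a,b);\mathbb{R}^n)$ are identified with their absolutely continuous representatives on $[a,b]$. $\mathscr{L}(u)=\int_a^bL(t,u(t),u'(t))\,dt$; $\mathscr{A}_{A,B}=\{u\in W^{1,1}((a,b);\mathbb{R}^n):u(a)=A,\ u(b)=B\}$; a minimizer of $\mathscr{L}$ over $\mathscr{A}_{v(a),v(b)}$ is $v$ with $\mathscr{L}(v)\le\mathscr{L}(u)$ for all $u\in\mathscr{A}_{v(a),v(b)}$. Condition (SC): for all $R\in[1,\infty)$ there exists $\tau_R>0$ such that for all $(t,y,p)\in[a,b]\times\mathbb{R}^n\times\mathbb{R}^n$ with $\max\{|t|,\|y\|,\|p\|\}\le R+1$ there exists a subdifferential (subgradient) $\xi\in\mathbb{R}^n$ of $L(t,y,\cdot)$ at $p$ (i.e. $L(t,y,q)\ge L(t,y,p)+\xi\cdot(q-p)$ for all $q\in\mathbb{R}^n$)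 such that $L(t,y,q)\ge L(t,y,p)+\xi\cdot(q-p)+2\tau_R$ whenever $\|q-p\|\ge R^{-1}$. One-sided derivatives: for scalar $v$, $D^-v(t)=\lim_{s\uparrow t}\frac{v(s)-v(t)}{s-t}$ and $D^+v(t)=\lim_{s\downarrow t}\frac{v(s)-v(t)}{s-t}$, whenever these limits make sense and exist as finite or infinite values; for vector-valued $v$ they are formed componentwise and exist iff they exist (as finite or infinite values) for each component. The index of the infinite component need not be the same on the two sides. *)

theory Defs
  imports "HOL-Analysis.Analysis"
begin

definition test_function :: "real \<Rightarrow> real \<Rightarrow> (real \<Rightarrow> real) \<Rightarrow> bool" where
  "test_function a b \<phi> \<longleftrightarrow>
     (\<forall>k x. (deriv ^^ k) \<phi> differentiable at x) \<and> closure {x. \<phi> x \<noteq> 0} \<subseteq> {a<..<b}"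

definition has_weak_derivative ::
    "real \<Rightarrow> real \<Rightarrow> (real \<Rightarrow> 'v::euclidean_space) \<Rightarrow> (real \<Rightarrow> 'v) \<Rightarrow> bool" where
  "has_weak_derivative a b u g \<longleftrightarrow>
     u absolutely_integrable_on {a<..<b} \<and> g absolutely_integrable_on {a<..<b} \<and>
     (\<forall>\<phi>. test_function a b \<phi> \<longrightarrow>
        (LINT t:{a<..<b}|lebesgue. deriv \<phi> t *\<^sub>R u t) =
        - (LINT t:{a<..<b}|lebesgue. \<phi> t *\<^sub>R g t))"

definition absolutely_continuous_fun ::
    "real \<Rightarrow> real \<Rightarrow> (real \<Rightarrow> 'v::euclidean_space) \<Rightarrow> bool" where
  "absolutely_continuous_fun a b u \<longleftrightarrow>
     (\<forall>\<epsilon>>0. \<exists>\<delta>>0. \<forall>\<D> S. \<D> division_of S \<and> S \<subseteq> {a..b} \<and> (\<Sum>I\<in>\<D>. Sup I - Inf I) < \<delta> \<longrightarrow>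
        (\<Sum>I\<in>\<D>. norm (u (Sup I) - u (Inf I))) < \<epsilon>)"

text \<open>
  Elements of the Sobolev space are represented by their absolutely continuous
  representatives on the closed interval, as functions on the whole real line whose values
  outside \<open>{a..b}\<close> are irrelevant.
\<close>

definition sobolev_W11 :: "real \<Rightarrow> real \<Rightarrow> (real \<Rightarrow> 'v::euclidean_space) set" where
  "sobolev_W11 a b = {u. absolutely_continuous_fun a b u \<and> (\<exists>g. has_weak_derivative a b u g)}"

text \<open>The weak derivative is unique almost everywhere, so the choice below does not affect integrals.\<close>

definition weak_deriv ::
    "real \<Rightarrow> real \<Rightarrow> (real \<Rightarrow> 'v::euclidean_space) \<Rightarrow> real \<Rightarrow> 'v" where
  "weak_deriv a b u = (SOME g. has_weak_derivative a b u g)"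

text \<open>
  The Lagrangian need not be bounded below and its integral may be infinite, so the
  functional takes extended real values: integral of the positive part minus integral of the
  negative part (\<open>ennreal\<close> maps negative reals to 0).  If \<open>L\<close> is continuous and
  \<open>strict_convexity_SC a b L\<close> holds, the negative part has finite integral for every
  \<open>u \<in> sobolev_W11 a b\<close>: on bounded sets of \<open>(t, y)\<close> the function \<open>L t y\<close> has an affine
  minorant with bounded coefficients.  Hence \<open>\<infinity> - \<infinity>\<close> does not occur.
\<close>

definition action ::
    "real \<Rightarrow> real \<Rightarrow> (real \<Rightarrow> 'v \<Rightarrow> 'v \<Rightarrow> real) \<Rightarrow> (real \<Rightarrow> 'v::euclidean_space) \<Rightarrow> ereal" where
  "action a b L u =
     enn2ereal (\<integral>\<^sup>+t\<in>{a..b}. ennreal (L t (u t) (weak_deriv a b u t)) \<partial>lebesgue) -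
     enn2ereal (\<integral>\<^sup>+t\<in>{a..b}. ennreal (- L t (u t) (weak_deriv a b u t)) \<partial>lebesgue)"

definition admissible ::
    "real \<Rightarrow> real \<Rightarrow> 'v \<Rightarrow> 'v \<Rightarrow> (real \<Rightarrow> 'v::euclidean_space) set" where
  "admissible a b A B = {u \<in> sobolev_W11 a b. u a = A \<and> u b = B}"

definition is_minimizer ::
    "real \<Rightarrow> real \<Rightarrow> (real \<Rightarrow> 'v \<Rightarrow> 'v \<Rightarrow> real) \<Rightarrow> (real \<Rightarrow> 'v::euclidean_space) \<Rightarrow> bool" where
  "is_minimizer a b L v \<longleftrightarrow>
     v \<in> sobolev_W11 a b \<and> (\<forall>u\<in>admissible a b (v a) (v b). action a b L v \<le> action a b L u)"

definition is_subgradient :: "('v::euclidean_space \<Rightarrow> real) \<Rightarrow> 'v \<Rightarrow> 'v \<Rightarrow> bool" where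
  "is_subgradient f p \<xi> \<longleftrightarrow> (\<forall>q. f q \<ge> f p + \<xi> \<bullet> (q - p))"

definition strict_convexity_SC ::
    "real \<Rightarrow> real \<Rightarrow> (real \<Rightarrow> 'v::euclidean_space \<Rightarrow> 'v \<Rightarrow> real) \<Rightarrow> bool" where
  "strict_convexity_SC a b L \<longleftrightarrow>
     (\<forall>R\<ge>1. \<exists>\<tau>>0. \<forall>t\<in>{a..b}. \<forall>y p. max \<bar>t\<bar> (max (norm y) (norm p)) \<le> R + 1 \<longrightarrow>
        (\<exists>\<xi>. is_subgradient (L t y) p \<xi> \<and>
             (\<forall>q. norm (q - p) \<ge> inverse R \<longrightarrow> L t y q \<ge> L t y p + \<xi> \<bullet> (q - p) + 2 * \<tau>)))"

text \<open>One-sided derivatives of scalar functions, with values in the extended reals.\<close>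

definition has_left_derivative :: "(real \<Rightarrow> real) \<Rightarrow> ereal \<Rightarrow> real \<Rightarrow> bool" where
  "has_left_derivative f d t \<longleftrightarrow> ((\<lambda>s. ereal ((f s - f t) / (s - t))) \<longlongrightarrow> d) (at_left t)"

definition has_right_derivative :: "(real \<Rightarrow> real) \<Rightarrow> ereal \<Rightarrow> real \<Rightarrow> bool" where
  "has_right_derivative f d t \<longleftrightarrow> ((\<lambda>s. ereal ((f s - f t) / (s - t))) \<longlongrightarrow> d) (at_right t)"

end

theory Submission
  imports Defs
begin

text \<open>
  Suppose that \<open>v\<close> has a bounded difference quotient on one side of \<open>t\<close>, say on the right, and
  that the difference quotient on the left blows up.  Put \<open>f r = v (t + r) - v t\<close> and
  \<open>g s = v (t - s) - v t\<close>.  For small \<open>s\<close> choose \<open>r = norm (g s)\<close>.  Since \<open>norm (g s) / s\<close>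
  tends to infinity, \<open>s\<close> is negligible against \<open>r\<close>, and the chord of \<open>v\<close> over
  \<open>{t - s..t + r}\<close> has slope approximately \<open>(f r - g s) / r\<close>.  This slope stays bounded,
  although \<open>v\<close> itself is arbitrarily steep on the left.  At the corner \<open>t\<close> the
  deviation of \<open>v\<close> from the chord is approximately \<open>norm (g s) = r\<close>, comparable with the
  length of the interval (\<open>no_mixed_slopes\<close>).

  A minimizer cannot do this.  Compare \<open>v\<close> with the function that replaces it by its chord, of
  slope \<open>P\<close>, over \<open>{\<alpha>..\<beta>}\<close>.  Near \<open>(t, v t)\<close> strict convexity gives a vector \<open>\<xi>\<close>,
  the same for all points of the interval, with
  \<open>L s (v s) q \<ge> L t (v t) P + \<xi> \<bullet> (q - P) + \<tau> R norm (q - P) - 5/4 \<tau>\<close> for all \<open>q\<close>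
  (\<open>local_uniform_strict_convexity\<close>).  Here \<open>R\<close> is as large as desired, and \<open>\<tau>\<close> depends only on
  \<open>R\<close>.  Insert \<open>q = v' s\<close> and integrate.  The linear term vanishes, because \<open>P\<close> is the mean of
  \<open>v'\<close>, and the action of the chord is at most \<open>(\<beta> - \<alpha>) (L t (v t) P + \<tau>/4)\<close>.  Minimality therefore
  bounds the mean of \<open>norm (v' - P)\<close> by \<open>3 / (2 R)\<close>, and \<open>v\<close> deviates from its chord by at most a
  small multiple of \<open>\<beta> - \<alpha>\<close> (\<open>minimizer_close_to_chord\<close>).  The estimate does not
  distinguish the two sides of \<open>t\<close>, so it yields both implications.

  The comparison needs some Sobolev theory on an interval: a function has weak derivative \<open>h\<close> if
  and only if it is an indefinite integral of \<open>h\<close>, up to the choice of a continuous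
  representative.  One direction tests with explicit smooth bumps
  (\<open>integral_eq_difference_if_weak_derivative\<close>), the other is integration by parts
  (\<open>has_weak_derivative_indefinite_integral\<close>).  The competitor is then constructed by changing the
  derivative on \<open>{\<alpha>..\<beta>}\<close> and integrating.
\<close>

section \<open>Smooth bump functions\<close>

text \<open>
  The derivative is an existential witness rather than \<open>deriv f\<close>, so that sums, products and
  affine substitutions preserve the property by plain induction, without a formula for higher
  derivatives.
\<close>

primrec times_differentiable :: "nat \<Rightarrow> (real \<Rightarrow> real) \<Rightarrow> bool" where
  "times_differentiable 0 f = True"
| "times_differentiable (Suc k) f =
     (\<exists>f'. (\<forall>x. (f has_real_derivative f' x) (at x)) \<and> times_differentiable k f')"

lemma times_differentiable_SucI:
  assumes "\<And>x. (f has_real_derivative f' x) (at x)" "times_differentiable k f'"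
  shows "times_differentiable (Suc k) f"
  using assms by (simp only: times_differentiable.simps) blast

lemma times_differentiable_SucE:
  assumes "times_differentiable (Suc k) f"
  obtains f' where "\<And>x. (f has_real_derivative f' x) (at x)" "times_differentiable k f'"
  using assms by (simp only: times_differentiable.simps) blast

lemma times_differentiable_mono:
  "times_differentiable (Suc k) f \<Longrightarrow> times_differentiable k f"
proof (induction k arbitrary: f)
  case (Suc k)
  obtain f' where f': "\<And>x. (f has_real_derivative f' x) (at x)" "times_differentiable (Suc k) f'"
    using Suc.prems by (rule times_differentiable_SucE) blast
  show ?case by (rule times_differentiable_SucI[OF f'(1) Suc.IH[OF f'(2)]])
qed simp

lemma times_differentiable_add:
  "times_differentiable k f \<Longrightarrow> times_differentiable k g \<Longrightarrow>
   times_differentiable k (\<lambda>x. f x + g x)"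
proof (induction k arbitrary: f g)
  case (Suc k)
  obtain f' where f': "\<And>x. (f has_real_derivative f' x) (at x)" "times_differentiable k f'"
    using Suc.prems(1) by (rule times_differentiable_SucE) blast
  obtain g' where g': "\<And>x. (g has_real_derivative g' x) (at x)" "times_differentiable k g'"
    using Suc.prems(2) by (rule times_differentiable_SucE) blast
  show ?case
    by (rule times_differentiable_SucI[OF DERIV_add[OF f'(1) g'(1)] Suc.IH[OF f'(2) g'(2)]])
qed simp

lemma times_differentiable_mult:
  "times_differentiable k f \<Longrightarrow> times_differentiable k g \<Longrightarrow>
   times_differentiable k (\<lambda>x. f x * g x)"
proof (induction k arbitrary: f g)
  case (Suc k)
  obtain f' where f': "\<And>x. (f has_real_derivative f' x) (at x)" "times_differentiable k f'"
    using Suc.prems(1) by (rule times_differentiable_SucE) blast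
  obtain g' where g': "\<And>x. (g has_real_derivative g' x) (at x)" "times_differentiable k g'"
    using Suc.prems(2) by (rule times_differentiable_SucE) blast
  note fg = Suc.prems[THEN times_differentiable_mono]
  show ?case
    by (rule times_differentiable_SucI[OF DERIV_mult[OF f'(1) g'(1)]
          times_differentiable_add[OF Suc.IH[OF f'(2) fg(2)] Suc.IH[OF g'(2) fg(1)]]])
qed simp

lemma times_differentiable_const: "times_differentiable k (\<lambda>x. c)"
proof (induction k arbitrary: c)
  case (Suc k)
  show ?case by (rule times_differentiable_SucI[OF DERIV_const Suc.IH])
qed simp

lemma times_differentiable_cmult:
  "times_differentiable k f \<Longrightarrow> times_differentiable k (\<lambda>x. c * f x)"
  by (rule times_differentiable_mult[OF times_differentiable_const])

lemma times_differentiable_affine: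
  "times_differentiable k f \<Longrightarrow> times_differentiable k (\<lambda>x. f (m * x + c))"
proof (induction k arbitrary: f)
  case (Suc k)
  obtain f' where f': "\<And>x. (f has_real_derivative f' x) (at x)" "times_differentiable k f'"
    using Suc.prems by (rule times_differentiable_SucE) blast
  have "((\<lambda>x. m * x + c) has_real_derivative m) (at x)" for x
    by (auto intro!: derivative_eq_intros)
  then have "((\<lambda>x. f (m * x + c)) has_real_derivative f' (m * x + c) * m) (at x)" for x
    by (rule DERIV_chain2[OF f'(1)])
  then show ?case
    using times_differentiable_cmult[OF Suc.IH[OF f'(2)], of m]
    by (intro times_differentiable_SucI[of f "\<lambda>x. m * f' (m * x + c)" for f]) (simp_all add: mult.commute)
qed simp

lemma times_differentiable_imp_deriv_differentiable:
  assumes "\<And>k. times_differentiable k f"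
  shows "(deriv ^^ k) f differentiable at x"
proof -
  have *: "\<forall>j. times_differentiable j (deriv f)" if "\<forall>j. times_differentiable j f" for f
  proof
    fix j
    have "times_differentiable (Suc j) f" using that by blast
    then obtain f' where f': "\<And>x. (f has_real_derivative f' x) (at x)" "times_differentiable j f'"
      by (rule times_differentiable_SucE) blast
    then have "deriv f = f'" by (auto simp: DERIV_imp_deriv)
    with f' show "times_differentiable j (deriv f)" by simp
  qed
  have "\<forall>j. times_differentiable j ((deriv ^^ k) f)"
    by (induction k) (use assms * in auto)
  then have "times_differentiable (Suc 0) ((deriv ^^ k) f)" by blast
  then obtain f' where "((deriv ^^ k) f has_real_derivative f' x) (at x)"
    by (rule times_differentiable_SucE) blast
  then show ?thesis
    by (auto simp: real_differentiable_def)
qed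

text \<open>
  The classical flat function is the case \<open>m = 0\<close>.  The extra powers of \<open>1 / x\<close> make the span of
  the family closed under differentiation.
\<close>

definition flat_exp :: "nat \<Rightarrow> real \<Rightarrow> real" where
  "flat_exp m x = (if 0 < x then exp (- inverse x) * inverse x ^ m else 0)"

lemma flat_exp_tendsto_0: "(flat_exp m \<longlongrightarrow> 0) (at_right 0)"
proof -
  have "((\<lambda>x::real. inverse x ^ m / exp (inverse x)) \<longlongrightarrow> 0) (at_right 0)"
    by (rule filterlim_compose[OF tendsto_power_div_exp_0 filterlim_inverse_at_top_right])
  then show ?thesis
    by (rule Lim_transform_eventually)
      (auto simp: flat_exp_def exp_minus field_simps eventually_at_filter)
qed

text \<open>
  The only delicate point is \<open>0\<close>.  There the difference quotient of \<open>flat_exp m\<close> from the right is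
  \<open>flat_exp (m + 1)\<close>, which tends to \<open>0\<close> because the exponential beats every power.
\<close>

lemma flat_exp_has_derivative:
  "(flat_exp m has_real_derivative flat_exp (m + 2) x + (- real m) * flat_exp (m + 1) x) (at x)"
proof -
  consider "x > 0" | "x < 0" | "x = 0" by linarith
  then show ?thesis
  proof cases
    case 1
    have "((\<lambda>x. exp (- inverse x) * inverse x ^ m) has_real_derivative
        flat_exp (m + 2) x + (- real m) * flat_exp (m + 1) x) (at x)"
    proof (cases m)
      case 0
      with 1 show ?thesis
        by (auto intro!: derivative_eq_intros simp: flat_exp_def power2_eq_square)
    next
      case (Suc k)
      have "((\<lambda>x. inverse x ^ Suc k) has_real_derivative
          real (Suc k) * (- (inverse x * inverse x) * inverse x ^ k)) (at x)"
        using DERIV_power_Suc[OF DERIV_inverse'[OF DERIV_ident, of x UNIV]] 1 by (simp add: mult.assoc)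
      moreover have "((\<lambda>x. exp (- inverse x)) has_real_derivative
          exp (- inverse x) * (inverse x * inverse x)) (at x)"
        using 1 by (auto intro!: derivative_eq_intros)
      ultimately have "((\<lambda>x. exp (- inverse x) * inverse x ^ Suc k) has_real_derivative
          exp (- inverse x) * (inverse x * inverse x) * inverse x ^ Suc k +
          real (Suc k) * (- (inverse x * inverse x) * inverse x ^ k) * exp (- inverse x)) (at x)"
        by (rule DERIV_mult[rotated])
      with 1 Suc show ?thesis by (simp add: flat_exp_def algebra_simps)
    qed
    then show ?thesis
      by (rule has_field_derivative_transform_within_open[where S="{0<..}"])
        (use 1 in \<open>auto simp: flat_exp_def\<close>)
  next
    case 2
    have "((\<lambda>x. 0) has_real_derivative 0) (at x)" by simp
    then have "(flat_exp m has_real_derivative 0) (at x)"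
      by (rule has_field_derivative_transform_within_open[where S="{..<0}"])
        (use 2 in \<open>auto simp: flat_exp_def\<close>)
    with 2 show ?thesis by (simp add: flat_exp_def)
  next
    case 3
    have "((\<lambda>y. (flat_exp m y - flat_exp m 0) / (y - 0)) \<longlongrightarrow> 0) (at_right 0)"
      by (rule Lim_transform_eventually[OF flat_exp_tendsto_0[of "Suc m"]])
        (auto simp: flat_exp_def field_simps eventually_at_filter)
    moreover have "((\<lambda>y. (flat_exp m y - flat_exp m 0) / (y - 0)) \<longlongrightarrow> 0) (at_left 0)"
      by (rule Lim_transform_eventually[OF tendsto_const])
        (auto simp: flat_exp_def eventually_at_filter)
    ultimately have "((\<lambda>y. (flat_exp m y - flat_exp m 0) / (y - 0)) \<longlongrightarrow> 0) (at 0)"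
      using filterlim_split_at by blast
    then have "(flat_exp m has_real_derivative 0) (at 0)"
      by (simp add: has_field_derivative_iff)
    with 3 show ?thesis by (simp add: flat_exp_def)
  qed
qed

lemma times_differentiable_flat_exp: "times_differentiable k (flat_exp m)"
proof (induction k arbitrary: m)
  case (Suc k)
  show ?case
    by (rule times_differentiable_SucI[OF flat_exp_has_derivative
          times_differentiable_add[OF Suc.IH times_differentiable_cmult[OF Suc.IH]]])
qed simp

lemma continuous_on_flat_exp [continuous_intros]:
  "continuous_on A f \<Longrightarrow> continuous_on A (\<lambda>x. flat_exp m (f x))"
  by (rule continuous_on_compose2[of UNIV "flat_exp m"])
    (auto intro: DERIV_continuous_on flat_exp_has_derivative)

lemma borel_measurable_flat_exp [measurable]: "flat_exp m \<in> borel_measurable borel"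
  by (rule borel_measurable_continuous_onI) (intro continuous_intros)

lemma flat_exp_nonneg: "0 \<le> flat_exp m x"
  by (simp add: flat_exp_def)

lemma flat_exp_0_le_1: "flat_exp 0 x \<le> 1"
  by (simp add: flat_exp_def)

text \<open>
  As \<open>n\<close> grows these bumps increase to the indicator function of \<open>{c<..<d}\<close>, because \<open>flat_exp 0\<close>
  is \<open>0\<close> up to the origin and tends to \<open>1\<close> at infinity.  They need no normalization, and
  their supports lie in \<open>{c..d}\<close> for every \<open>n\<close>.
\<close>

definition bump :: "real \<Rightarrow> real \<Rightarrow> nat \<Rightarrow> real \<Rightarrow> real" where
  "bump c d n x = flat_exp 0 (real n * (x - c)) * flat_exp 0 (real n * (d - x))"

lemma bump_bounds: "0 \<le> bump c d n x" "bump c d n x \<le> 1"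
  by (auto simp: bump_def flat_exp_nonneg flat_exp_0_le_1 mult_le_one)

lemma bump_eq_0:
  assumes "x \<notin> {c<..<d}"
  shows "bump c d n x = 0"
proof -
  have "real n * (x - c) \<le> 0 \<or> real n * (d - x) \<le> 0"
    using assms by (auto simp: not_less intro!: mult_nonneg_nonpos)
  then show ?thesis by (auto simp: bump_def flat_exp_def)
qed

lemma test_function_bump:
  assumes "a < c" "d < b"
  shows "test_function a b (bump c d n)"
proof -
  have eq: "bump c d n = (\<lambda>x. flat_exp 0 (real n * x + (- real n * c)) * flat_exp 0 ((- real n) * x + real n * d))"
    by (auto simp: bump_def algebra_simps)
  have "times_differentiable k (bump c d n)" for k
    unfolding eq
    by (intro times_differentiable_mult times_differentiable_affine times_differentiable_flat_exp)
  moreover have "closure {x. bump c d n x \<noteq> 0} \<subseteq> {c..d}"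
  proof (rule closure_minimal)
    show "{x. bump c d n x \<noteq> 0} \<subseteq> {c..d}"
    proof
      fix x assume "x \<in> {x. bump c d n x \<noteq> 0}"
      then have "x \<in> {c<..<d}" using bump_eq_0[of x c d n] by blast
      then show "x \<in> {c..d}" by simp
    qed
  qed simp
  ultimately show ?thesis
    using assms times_differentiable_imp_deriv_differentiable unfolding test_function_def by fastforce
qed

lemma deriv_bump:
  "deriv (bump c d n) x =
     real n * flat_exp 2 (real n * (x - c)) * flat_exp 0 (real n * (d - x))
     - flat_exp 0 (real n * (x - c)) * (real n * flat_exp 2 (real n * (d - x)))"
proof -
  have *: "(flat_exp 0 has_real_derivative flat_exp 2 y) (at y)" for y
    using flat_exp_has_derivative[of 0 y] by (simp add: numeral_2_eq_2)
  have "((\<lambda>x. flat_exp 0 (real n * (x - c)) * flat_exp 0 (real n * (d - x))) has_real_derivative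
      real n * flat_exp 2 (real n * (x - c)) * flat_exp 0 (real n * (d - x))
     - flat_exp 0 (real n * (x - c)) * (real n * flat_exp 2 (real n * (d - x)))) (at x)"
  proof -
    have "((\<lambda>x. real n * (x - c)) has_real_derivative real n) (at x)"
      "((\<lambda>x. real n * (d - x)) has_real_derivative - real n) (at x)"
      by (auto intro!: derivative_eq_intros)
    from DERIV_mult[OF DERIV_chain2[OF * this(1)] DERIV_chain2[OF * this(2)]]
    show ?thesis by (simp add: algebra_simps)
  qed
  then show ?thesis by (simp add: bump_def[abs_def] DERIV_imp_deriv)
qed

lemma flat_exp_0_tendsto_1: "(flat_exp 0 \<longlongrightarrow> 1) at_top"
proof -
  have "((\<lambda>x::real. exp (- inverse x)) \<longlongrightarrow> exp (- 0)) at_top"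
    by (intro tendsto_intros tendsto_inverse_0_at_top filterlim_ident)
  then have "((\<lambda>x::real. exp (- inverse x)) \<longlongrightarrow> 1) at_top" by simp
  then show ?thesis
    by (rule Lim_transform_eventually)
      (auto simp: flat_exp_def intro!: eventually_mono[OF eventually_gt_at_top[of 0]])
qed

lemma flat_exp_0_scaled_tendsto:
  assumes "l > 0"
  shows "(\<lambda>n. flat_exp 0 (real n * l + y)) \<longlonglongrightarrow> 1"
proof -
  have "filterlim (\<lambda>n. real n * l) at_top sequentially"
    using filterlim_tendsto_pos_mult_at_top[OF tendsto_const assms filterlim_real_sequentially]
    by (simp add: mult.commute)
  then have "filterlim (\<lambda>n. y + real n * l) at_top sequentially"
    by (rule filterlim_tendsto_add_at_top[OF tendsto_const])
  then show ?thesis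
    by (intro filterlim_compose[OF flat_exp_0_tendsto_1]) (simp add: add.commute)
qed

lemma bump_tendsto:
  assumes "x \<in> {c<..<d}"
  shows "(\<lambda>n. bump c d n x) \<longlonglongrightarrow> 1"
  using tendsto_mult[OF flat_exp_0_scaled_tendsto[of "x - c" 0] flat_exp_0_scaled_tendsto[of "d - x" 0]] assms
  by (auto simp: bump_def)

text \<open>
  \<open>flat_exp 2\<close> is the derivative of \<open>flat_exp 0\<close>, which climbs from \<open>0\<close> to \<open>1\<close>; so it is the
  density of a probability measure.
\<close>

lemma has_bochner_integral_flat_exp_2: "has_bochner_integral lborel (flat_exp 2) 1"
proof -
  have *: "(flat_exp 0 has_real_derivative flat_exp 2 y) (at y)" for y
    using flat_exp_has_derivative[of 0 y] by (simp add: numeral_2_eq_2)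
  have "(\<integral>\<^sup>+x. ennreal (flat_exp 2 x) * indicator {0..} x \<partial>lborel) = ennreal (1 - flat_exp 0 0)"
    by (rule nn_integral_FTC_atLeast[OF _ _ _ flat_exp_0_tendsto_1]) (use * flat_exp_nonneg in auto)
  moreover have "ennreal (flat_exp 2 x) * indicator {0..} x = ennreal (flat_exp 2 x)" for x
    by (auto simp: flat_exp_def indicator_def)
  ultimately show ?thesis
    by (intro has_bochner_integral_nn_integral) (auto simp: flat_exp_nonneg flat_exp_def)
qed

text \<open>
  This is the part of \<open>deriv (bump c d n)\<close> that concentrates at \<open>c\<close>.  The substitution
  \<open>x = c + y / n\<close> turns it into an average of the values \<open>u (c + y / n)\<close> with density
  \<open>flat_exp 2\<close>, and the remaining factor tends to \<open>1\<close>.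
\<close>

lemma left_bump_mass_tendsto:
  fixes u :: "real \<Rightarrow> 'v::euclidean_space"
  assumes u: "continuous_on UNIV u" and bd: "\<And>x. norm (u x) \<le> B" and "c < d"
  shows "(\<lambda>n. \<integral>x. (real n * flat_exp 2 (real n * (x - c)) * flat_exp 0 (real n * (d - x))) *\<^sub>R u x \<partial>lborel)
           \<longlonglongrightarrow> u c"
proof -
  have [measurable]: "u \<in> borel_measurable borel" using u by (rule borel_measurable_continuous_onI)
  have int: "integrable lborel (flat_exp 2)" and one: "(\<integral>x. flat_exp 2 x \<partial>lborel) = 1"
    using has_bochner_integral_flat_exp_2 by (auto simp: has_bochner_integral_iff)
  let ?s = "\<lambda>n y. (flat_exp 2 y * flat_exp 0 (real n * (d - c) - y)) *\<^sub>R u (c + y / real n)"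
  have "(\<lambda>n. \<integral>y. ?s n y \<partial>lborel) \<longlonglongrightarrow> (\<integral>y. flat_exp 2 y *\<^sub>R u c \<partial>lborel)"
  proof (rule integral_dominated_convergence[where w="\<lambda>y. B * flat_exp 2 y"])
    show "integrable lborel (\<lambda>y. B * flat_exp 2 y)" using int by simp
    show "AE y in lborel. norm (?s n y) \<le> B * flat_exp 2 y" for n
    proof (rule AE_I2)
      fix y
      have "flat_exp 2 y * flat_exp 0 (real n * (d - c) - y) * norm (u (c + y / real n)) \<le> flat_exp 2 y * 1 * B"
        by (intro mult_mono bd flat_exp_0_le_1) (auto simp: flat_exp_nonneg)
      then show "norm (?s n y) \<le> B * flat_exp 2 y"
        by (simp add: flat_exp_nonneg abs_mult algebra_simps)
    qed
    show "AE y in lborel. (\<lambda>n. ?s n y) \<longlonglongrightarrow> flat_exp 2 y *\<^sub>R u c"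
    proof (rule AE_I2)
      fix y
      have "(\<lambda>n. c + y / real n) \<longlonglongrightarrow> c + 0"
        by (intro tendsto_intros lim_const_over_n)
      then have 1: "(\<lambda>n. u (c + y / real n)) \<longlonglongrightarrow> u c"
        using u by (auto intro!: continuous_on_tendsto_compose[OF u])
      have 2: "(\<lambda>n. flat_exp 0 (real n * (d - c) - y)) \<longlonglongrightarrow> 1"
        using flat_exp_0_scaled_tendsto[of "d - c" "- y"] \<open>c < d\<close> by simp
      show "(\<lambda>n. ?s n y) \<longlonglongrightarrow> flat_exp 2 y *\<^sub>R u c"
        using tendsto_scaleR[OF tendsto_mult[OF tendsto_const 2, of "flat_exp 2 y"] 1] by simp
    qed
  qed measurable
  moreover have "(\<integral>y. flat_exp 2 y *\<^sub>R u c \<partial>lborel) = u c"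
    using int one by simp
  moreover have "(\<integral>y. ?s n y \<partial>lborel) =
      (\<integral>x. (real n * flat_exp 2 (real n * (x - c)) * flat_exp 0 (real n * (d - x))) *\<^sub>R u x \<partial>lborel)"
    if "n > 0" for n
  proof -
    have "real n * (d - (c + y / real n)) = real n * (d - c) - y" for y
      using that by (simp add: field_simps)
    with that show ?thesis
      by (subst (2) lborel_integral_real_affine[where c="1 / real n" and t=c])
         (simp_all flip: integral_scaleR_right)
  qed
  ultimately have lim: "(\<lambda>n. \<integral>y. ?s n y \<partial>lborel) \<longlonglongrightarrow> u c"
    and ev: "\<forall>\<^sub>F n in sequentially. (\<integral>y. ?s n y \<partial>lborel) =
      (\<integral>x. (real n * flat_exp 2 (real n * (x - c)) * flat_exp 0 (real n * (d - x))) *\<^sub>R u x \<partial>lborel)"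
    by (auto intro: eventually_sequentiallyI[of 1])
  show ?thesis by (rule Lim_transform_eventually[OF lim ev])
qed

section \<open>The weak derivative is the density of the increments\<close>

text \<open>
  The mirror image of the concentration at the left end point, under \<open>x \<mapsto> - x\<close>.
\<close>

lemma right_bump_mass_tendsto:
  fixes u :: "real \<Rightarrow> 'v::euclidean_space"
  assumes u: "continuous_on UNIV u" and bd: "\<And>x. norm (u x) \<le> B" and "c < d"
  shows "(\<lambda>n. \<integral>x. (flat_exp 0 (real n * (x - c)) * (real n * flat_exp 2 (real n * (d - x)))) *\<^sub>R u x \<partial>lborel)
           \<longlonglongrightarrow> u d"
proof -
  have "continuous_on UNIV (\<lambda>x. u (- x))"
    by (rule continuous_on_compose2[OF u]) (auto intro: continuous_intros)
  from left_bump_mass_tendsto[OF this, of B "- d" "- c"] bd \<open>c < d\<close>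
  have "(\<lambda>n. \<integral>x. (real n * flat_exp 2 (real n * (x + d)) * flat_exp 0 (real n * (- c - x))) *\<^sub>R u (- x) \<partial>lborel)
          \<longlonglongrightarrow> u d" by simp
  moreover have "(\<integral>x. (flat_exp 0 (real n * (x - c)) * (real n * flat_exp 2 (real n * (d - x)))) *\<^sub>R u x \<partial>lborel)
      = (\<integral>x. (real n * flat_exp 2 (real n * (x + d)) * flat_exp 0 (real n * (- c - x))) *\<^sub>R u (- x) \<partial>lborel)" for n
    by (subst lborel_integral_real_affine[where c="-1" and t=0])
       (simp_all add: algebra_simps)
  ultimately show ?thesis by simp
qed

text \<open>
  Test the weak derivative with the bumps over \<open>{c..d}\<close>.  The side containing the derivative of
  the bump tends to \<open>u c - u d\<close>, and by dominated convergence the other side tends to minus the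
  integral of \<open>g\<close> over \<open>{c..d}\<close>.
\<close>

lemma integral_eq_difference_if_weak_derivative_interior:
  fixes u g :: "real \<Rightarrow> 'v::euclidean_space"
  assumes wd: "has_weak_derivative a b u g" and cont: "continuous_on {a..b} u"
    and "a < c" "c < d" "d < b"
  shows "integral {c..d} g = u d - u c"
proof -
  \<comment> \<open>The approximation lemmas need a bounded continuous function on the whole line.\<close>
  define w where "w x = u (max a (min b x))" for x
  have w_eq: "w x = u x" if "x \<in> {a..b}" for x using that by (simp add: w_def)
  have w_cont: "continuous_on UNIV w"
    unfolding w_def by (rule continuous_on_compose2[OF cont]) (use assms in \<open>auto intro!: continuous_intros\<close>)
  have "compact (u ` {a..b})" by (rule compact_continuous_image[OF cont]) simp
  then obtain B where B: "\<And>x. x \<in> {a..b} \<Longrightarrow> norm (u x) \<le> B"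
    by (meson bounded_iff compact_imp_bounded imageI)
  have w_bd: "norm (w x) \<le> B" for x
    unfolding w_def by (rule B) (use assms in auto)
  let ?l = "\<lambda>n x. real n * flat_exp 2 (real n * (x - c)) * flat_exp 0 (real n * (d - x))"
  let ?r = "\<lambda>n x. flat_exp 0 (real n * (x - c)) * (real n * flat_exp 2 (real n * (d - x)))"
  have zero: "flat_exp i (real n * (x - c)) = 0 \<or> flat_exp j (real n * (d - x)) = 0"
    if "x \<notin> {c..d}" for i j n x
  proof -
    have "real n * (x - c) \<le> 0 \<or> real n * (d - x) \<le> 0"
      using that by (auto simp: not_le intro!: mult_nonneg_nonpos)
    then show ?thesis by (auto simp: flat_exp_def)
  qed
  have int: "integrable lborel (\<lambda>x. k x *\<^sub>R w x)"
    if "continuous_on UNIV k" "\<And>x. x \<notin> {c..d} \<Longrightarrow> k x = 0" for k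
  proof -
    have "set_integrable lborel {c..d} (\<lambda>x. k x *\<^sub>R w x)"
      by (rule borel_integrable_atLeastAtMost')
        (auto intro!: continuous_intros intro: continuous_on_subset[OF that(1)] continuous_on_subset[OF w_cont])
    then show ?thesis
      unfolding set_integrable_def
      by (rule iffD1[OF Bochner_Integration.integrable_cong, rotated -1])
        (use that(2) in \<open>auto simp: indicator_def\<close>)
  qed
  have L: "integrable lborel (\<lambda>x. ?l n x *\<^sub>R w x)" and R: "integrable lborel (\<lambda>x. ?r n x *\<^sub>R w x)" for n
  proof -
    have "?l n x = 0" "?r n x = 0" if "x \<notin> {c..d}" for x
      using zero[OF that, of 2 n 0] zero[OF that, of 0 n 2] by fastforce+
    then show "integrable lborel (\<lambda>x. ?l n x *\<^sub>R w x)" "integrable lborel (\<lambda>x. ?r n x *\<^sub>R w x)"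
      by (auto intro!: int continuous_intros)
  qed
  have lhs: "(LINT t:{a<..<b}|lebesgue. deriv (bump c d n) t *\<^sub>R u t) =
     (\<integral>x. ?l n x *\<^sub>R w x \<partial>lborel) - (\<integral>x. ?r n x *\<^sub>R w x \<partial>lborel)" for n
  proof -
    have "indicator {a<..<b} t *\<^sub>R deriv (bump c d n) t *\<^sub>R u t = ?l n t *\<^sub>R w t - ?r n t *\<^sub>R w t" for t
    proof (cases "t \<in> {c..d}")
      case True
      then have "t \<in> {a<..<b}" using assms by auto
      then show ?thesis using w_eq[of t] by (simp add: deriv_bump scaleR_left_diff_distrib)
    next
      case False
      then have "?l n t = 0" "?r n t = 0"
        using zero[OF False, of 2 n 0] zero[OF False, of 0 n 2] by fastforce+
      moreover from this have "deriv (bump c d n) t = 0" by (simp only: deriv_bump diff_self)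
      ultimately show ?thesis by (simp only: scaleR_zero_left scaleR_zero_right diff_self)
    qed
    then have "(LINT t:{a<..<b}|lebesgue. deriv (bump c d n) t *\<^sub>R u t)
       = (\<integral>t. ?l n t *\<^sub>R w t - ?r n t *\<^sub>R w t \<partial>lebesgue)"
      unfolding set_lebesgue_integral_def by (simp only:)
    also have "\<dots> = (\<integral>t. ?l n t *\<^sub>R w t - ?r n t *\<^sub>R w t \<partial>lborel)"
      using borel_measurable_integrable[OF Bochner_Integration.integrable_diff[OF L R]]
      by (rule integral_completion)
    also have "\<dots> = (\<integral>x. ?l n x *\<^sub>R w x \<partial>lborel) - (\<integral>x. ?r n x *\<^sub>R w x \<partial>lborel)"
      by (rule Bochner_Integration.integral_diff[OF L R])
    finally show ?thesis .
  qed
  have lim1: "(\<lambda>n. LINT t:{a<..<b}|lebesgue. deriv (bump c d n) t *\<^sub>R u t) \<longlonglongrightarrow> w c - w d"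
    unfolding lhs
    by (intro tendsto_diff left_bump_mass_tendsto[OF w_cont w_bd] right_bump_mass_tendsto[OF w_cont w_bd] \<open>c < d\<close>)
  have g: "integrable lebesgue (\<lambda>t. indicator {a<..<b} t *\<^sub>R g t)"
    using wd by (simp add: has_weak_derivative_def set_integrable_def)
  have "(\<lambda>n. LINT t|lebesgue. bump c d n t *\<^sub>R (indicator {a<..<b} t *\<^sub>R g t))
      \<longlonglongrightarrow> (LINT t|lebesgue. indicator {c<..<d} t *\<^sub>R (indicator {a<..<b} t *\<^sub>R g t))"
  proof (rule integral_dominated_convergence[where w="\<lambda>t. norm (indicator {a<..<b} t *\<^sub>R g t)"])
    show "(\<lambda>t. indicator {c<..<d} t *\<^sub>R (indicator {a<..<b} t *\<^sub>R g t)) \<in> borel_measurable lebesgue"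
      by (rule borel_measurable_scaleR[OF borel_measurable_indicator borel_measurable_integrable[OF g]]) simp
    have "continuous_on UNIV (bump c d n)" for n
      unfolding bump_def by (intro continuous_intros)
    then have "bump c d n \<in> borel_measurable lborel" for n
      using borel_measurable_continuous_onI[of "bump c d n"] by simp
    then have "bump c d n \<in> borel_measurable lebesgue" for n
      by (rule measurable_completion)
    then show "(\<lambda>t. bump c d n t *\<^sub>R (indicator {a<..<b} t *\<^sub>R g t)) \<in> borel_measurable lebesgue" for n
      by (rule borel_measurable_scaleR[OF _ borel_measurable_integrable[OF g]])
    show "integrable lebesgue (\<lambda>t. norm (indicator {a<..<b} t *\<^sub>R g t))" using g by (rule integrable_norm)
    show "AE t in lebesgue. (\<lambda>n. bump c d n t *\<^sub>R (indicator {a<..<b} t *\<^sub>R g t)) \<longlonglongrightarrow>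
        indicator {c<..<d} t *\<^sub>R (indicator {a<..<b} t *\<^sub>R g t)"
    proof (rule AE_I2)
      fix t
      have "(\<lambda>n. bump c d n t) \<longlonglongrightarrow> indicator {c<..<d} t"
        using bump_tendsto[of t c d] bump_eq_0[of t c d] by (cases "t \<in> {c<..<d}") auto
      then show "(\<lambda>n. bump c d n t *\<^sub>R (indicator {a<..<b} t *\<^sub>R g t)) \<longlonglongrightarrow>
        indicator {c<..<d} t *\<^sub>R (indicator {a<..<b} t *\<^sub>R g t)"
        by (intro tendsto_intros)
    qed
    show "AE t in lebesgue. norm (bump c d n t *\<^sub>R (indicator {a<..<b} t *\<^sub>R g t))
      \<le> norm (indicator {a<..<b} t *\<^sub>R g t)" for n
    proof (rule AE_I2)
      fix t
      have "\<bar>bump c d n t\<bar> * norm (indicator {a<..<b} t *\<^sub>R g t) \<le> 1 * norm (indicator {a<..<b} t *\<^sub>R g t)"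
        by (intro mult_right_mono) (simp_all add: bump_bounds)
      then show "norm (bump c d n t *\<^sub>R (indicator {a<..<b} t *\<^sub>R g t)) \<le> norm (indicator {a<..<b} t *\<^sub>R g t)"
        by (simp only: norm_scaleR real_norm_def mult_1)
    qed
  qed
  moreover have "(LINT t|lebesgue. bump c d n t *\<^sub>R (indicator {a<..<b} t *\<^sub>R g t))
     = - (LINT t:{a<..<b}|lebesgue. deriv (bump c d n) t *\<^sub>R u t)" for n
  proof -
    have "(LINT t:{a<..<b}|lebesgue. deriv (bump c d n) t *\<^sub>R u t)
        = - (LINT t:{a<..<b}|lebesgue. bump c d n t *\<^sub>R g t)"
      using wd test_function_bump[of a c d b n] assms unfolding has_weak_derivative_def by blast
    then show ?thesis unfolding set_lebesgue_integral_def by (simp add: mult.commute)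
  qed
  moreover have "(LINT t|lebesgue. indicator {c<..<d} t *\<^sub>R (indicator {a<..<b} t *\<^sub>R g t)) = integral {c..d} g"
  proof -
    have "indicator {c<..<d} t *\<^sub>R (indicator {a<..<b} t *\<^sub>R g t) = indicator {c<..<d} t *\<^sub>R g t" for t
      using assms by (auto simp: indicator_def)
    then have "(LINT t|lebesgue. indicator {c<..<d} t *\<^sub>R (indicator {a<..<b} t *\<^sub>R g t)) = (LINT t:{c<..<d}|lebesgue. g t)"
      unfolding set_lebesgue_integral_def by (simp only:)
    also have "\<dots> = integral {c<..<d} g"
    proof (rule set_lebesgue_integral_eq_integral(2))
      have "g absolutely_integrable_on {a<..<b}" using wd by (simp add: has_weak_derivative_def)
      then show "g absolutely_integrable_on {c<..<d}"
        by (rule set_integrable_subset) (use assms in auto)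
    qed
    also have "\<dots> = integral {c..d} g" by (simp add: integral_open_interval_real)
    finally show ?thesis .
  qed
  ultimately have "(\<lambda>n. - (LINT t:{a<..<b}|lebesgue. deriv (bump c d n) t *\<^sub>R u t)) \<longlonglongrightarrow> integral {c..d} g"
    by simp
  from LIMSEQ_unique[OF this tendsto_minus[OF lim1]] show ?thesis
    using w_eq[of c] w_eq[of d] assms by simp
qed

lemma weak_derivative_absolutely_integrable:
  "has_weak_derivative a b u g \<Longrightarrow> g absolutely_integrable_on {a..b}"
  by (simp add: has_weak_derivative_def absolutely_integrable_on_Icc_iff_Ioo)

text \<open>
  The bumps only reach intervals inside \<open>{a<..<b}\<close>.  The end points follow because
  \<open>u\<close> minus the indefinite integral of \<open>g\<close> is continuous on \<open>{a..b}\<close> and constant on its interior.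
\<close>

lemma integral_eq_difference_if_weak_derivative:
  fixes u g :: "real \<Rightarrow> 'v::euclidean_space"
  assumes wd: "has_weak_derivative a b u g" and cont: "continuous_on {a..b} u"
    and x: "a \<le> x" "x \<le> b"
  shows "integral {a..x} g = u x - u a"
proof (cases "a < b")
  case True
  have gi: "g integrable_on {a..b}"
    using weak_derivative_absolutely_integrable[OF wd] by (rule absolutely_integrable_on_def[THEN iffD1, THEN conjunct1])
  let ?w = "\<lambda>x. u x - integral {a..x} g"
  have w_cont: "continuous_on {a..b} ?w"
    by (intro continuous_on_diff cont indefinite_integral_continuous_1 gi)
  obtain m where m: "a < m" "m < b" using dense[OF True] by blast
  have const: "?w y = ?w m" if "y \<in> {a<..<b}" for y
  proof -
    have *: "?w d = ?w c" if "a < c" "c < d" "d < b" for c d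
    proof -
      have "integral {a..c} g + integral {c..d} g = integral {a..d} g"
        by (rule Henstock_Kurzweil_Integration.integral_combine)
          (use that in \<open>auto intro: integrable_on_subinterval[OF gi]\<close>)
      then have "integral {a..d} g = integral {a..c} g + (u d - u c)"
        using integral_eq_difference_if_weak_derivative_interior[OF wd cont that] by simp
      then show ?thesis by (simp add: algebra_simps)
    qed
    with *[of y m] *[of m y] that m show ?thesis
      by (cases "y = m") (auto simp: neq_iff[of y m])
  qed
  have cl: "closure {a<..<b} = {a..b}" using True by simp
  have "?w y = ?w m" if "y \<in> {a..b}" for y
    by (rule continuous_constant_on_closure[of "{a<..<b}"]) (use cl w_cont const that in auto)
  from this[of x] this[of a] have "?w x = ?w a" using x True by simp
  then show ?thesis by (simp add: diff_eq_eq eq_diff_eq add.commute)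
next
  case False
  with x have "x = a" by simp
  then show ?thesis by simp
qed

lemma integral_eq_difference_if_weak_derivative_between:
  fixes u g :: "real \<Rightarrow> 'v::euclidean_space"
  assumes wd: "has_weak_derivative a b u g" and cont: "continuous_on {a..b} u"
    and x: "a \<le> x" "x \<le> y" "y \<le> b"
  shows "integral {x..y} g = u y - u x"
proof -
  have gi: "g integrable_on {a..b}"
    using weak_derivative_absolutely_integrable[OF wd] by (rule absolutely_integrable_on_def[THEN iffD1, THEN conjunct1])
  have "integral {a..x} g + integral {x..y} g = integral {a..y} g"
    by (rule Henstock_Kurzweil_Integration.integral_combine)
      (use x in \<open>auto intro: integrable_on_subinterval[OF gi]\<close>)
  moreover have "integral {a..x} g = u x - u a" "integral {a..y} g = u y - u a"
    using x by (auto intro!: integral_eq_difference_if_weak_derivative[OF wd cont])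
  ultimately have "u x - u a + integral {x..y} g = u y - u a" by simp
  then have "integral {x..y} g = (u y - u a) - (u x - u a)" by (metis add_diff_cancel_left')
  then show ?thesis by simp
qed

section \<open>Indefinite integrals are weakly differentiable\<close>

text \<open>
  A version of "derivative zero implies constant" in which increments are compared with those of
  \<open>M\<close> instead of with lengths; summing over a fine equidistant partition gives
  \<open>norm (F b - F a) \<le> \<epsilon> (M b - M a)\<close>.
\<close>

lemma end_points_eq_if_increments_small:
  fixes F :: "real \<Rightarrow> 'v::real_normed_vector" and M :: "real \<Rightarrow> real"
  assumes "a \<le> b"
    and small: "\<And>\<epsilon>. \<epsilon> > 0 \<Longrightarrow> \<exists>\<delta>>0. \<forall>x y. a \<le> x \<and> x \<le> y \<and> y \<le> b \<and> y - x < \<delta> \<longrightarrow>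
                   norm (F y - F x) \<le> \<epsilon> * (M y - M x)"
  shows "F b = F a"
proof -
  have le: "norm (F b - F a) \<le> \<epsilon> * (M b - M a)" if eps: "\<epsilon> > 0" for \<epsilon>
  proof -
    obtain \<delta> where \<delta>: "\<delta> > 0" "\<And>x y. a \<le> x \<Longrightarrow> x \<le> y \<Longrightarrow> y \<le> b \<Longrightarrow> y - x < \<delta> \<Longrightarrow>
                   norm (F y - F x) \<le> \<epsilon> * (M y - M x)"
      using small[OF eps] by blast
    obtain n :: nat where n: "(b - a) / \<delta> < real n" using reals_Archimedean2 by blast
    then have n0: "n > 0" using \<open>a \<le> b\<close> \<delta>(1) by (intro gr0I) (auto simp: divide_less_0_iff)
    define h where "h = (b - a) / real n"
    have h: "0 \<le> h" "h < \<delta>" "a + real n * h = b"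
      using n n0 \<open>a \<le> b\<close> \<delta>(1) by (auto simp: h_def field_simps)
    have "norm (F (a + real (Suc k) * h) - F (a + real k * h))
        \<le> \<epsilon> * (M (a + real (Suc k) * h) - M (a + real k * h))" if "k < n" for k
    proof (rule \<delta>(2))
      have "real (Suc k) * h \<le> real n * h" using that h(1) by (intro mult_right_mono) auto
      then show "a + real (Suc k) * h \<le> b" using h(3) by linarith
    qed (use h in \<open>auto simp: algebra_simps\<close>)
    then have "norm (\<Sum>k<n. F (a + real (Suc k) * h) - F (a + real k * h))
        \<le> (\<Sum>k<n. \<epsilon> * (M (a + real (Suc k) * h) - M (a + real k * h)))"
      by (intro sum_norm_le) simp
    then show ?thesis
      using sum_lessThan_telescope[of "\<lambda>k. F (a + real k * h)" n]
        sum_lessThan_telescope[of "\<lambda>k. M (a + real k * h)" n] h(3)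
      by (simp only: sum_distrib_left[symmetric]) simp
  qed
  have "norm (F b - F a) \<le> 0"
  proof (rule field_le_epsilon)
    fix e :: real assume "e > 0"
    have "norm (F b - F a) \<le> e / (\<bar>M b - M a\<bar> + 1) * (M b - M a)"
      using \<open>e > 0\<close> by (intro le) (auto intro!: divide_pos_pos)
    also have "\<dots> \<le> e / (\<bar>M b - M a\<bar> + 1) * (\<bar>M b - M a\<bar> + 1)"
      using \<open>e > 0\<close> by (intro mult_left_mono) auto
    also have "\<dots> = e" by simp
    finally show "norm (F b - F a) \<le> 0 + e" by simp
  qed
  then show ?thesis by simp
qed

lemma absolutely_integrable_continuous_scaleR:
  fixes h :: "real \<Rightarrow> 'v::euclidean_space" and \<phi> :: "real \<Rightarrow> real"
  assumes "h absolutely_integrable_on {a..b}" and \<phi>: "continuous_on {a..b} \<phi>"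
  shows "(\<lambda>x. \<phi> x *\<^sub>R h x) absolutely_integrable_on {a..b}"
proof (rule absolutely_integrable_bounded_measurable_product[OF bilinear_conv_bounded_bilinear[THEN iffD2, OF bounded_bilinear_scaleR]])
  show "bounded (\<phi> ` {a..b})"
    using compact_continuous_image[OF \<phi> compact_Icc] by (rule compact_imp_bounded)
  show "\<phi> \<in> borel_measurable (lebesgue_on {a..b})"
    by (rule continuous_imp_measurable_on_sets_lebesgue[OF \<phi>]) simp
qed (use assms in auto)

text \<open>
  Let \<open>F x\<close> be \<open>\<phi> x *\<^sub>R u x\<close> minus the two integrals up to \<open>x\<close>.  Over a short interval
  \<open>{x..y}\<close> the increment of \<open>F\<close> is the integral of
  \<open>\<phi>' s *\<^sub>R (u y - u s) + (\<phi> x - \<phi> s) *\<^sub>R h s\<close>.  By uniform continuity of \<open>u\<close> and \<open>\<phi>\<close> this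
  is at most \<open>\<epsilon>\<close> times the increment of \<open>C x + integral {a..x} (norm \<circ> h)\<close>, so \<open>F\<close> has equal
  values at the end points.
\<close>

lemma integration_by_parts_indefinite_integral:
  fixes h :: "real \<Rightarrow> 'v::euclidean_space" and \<phi> \<phi>' :: "real \<Rightarrow> real"
  assumes "a \<le> b" and h: "h absolutely_integrable_on {a..b}"
    and u: "\<And>x. x \<in> {a..b} \<Longrightarrow> u x = u a + integral {a..x} h"
    and \<phi>: "\<And>x. (\<phi> has_real_derivative \<phi>' x) (at x)" and \<phi>': "continuous_on UNIV \<phi>'"
  shows "integral {a..b} (\<lambda>x. \<phi>' x *\<^sub>R u x) + integral {a..b} (\<lambda>x. \<phi> x *\<^sub>R h x)
    = \<phi> b *\<^sub>R u b - \<phi> a *\<^sub>R u a"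
proof -
  have hi: "h integrable_on {c..d}" if "a \<le> c" "d \<le> b" for c d
    using that by (intro integrable_on_subinterval[OF set_lebesgue_integral_eq_integral(1)[OF h]]) auto
  have nh: "(\<lambda>x. norm (h x)) integrable_on {c..d}" if "a \<le> c" "d \<le> b" for c d
  proof (rule integrable_on_subinterval)
    show "(\<lambda>x. norm (h x)) integrable_on {a..b}" using h by (simp add: absolutely_integrable_on_def)
  qed (use that in auto)
  have u_cont: "continuous_on {a..b} u"
  proof -
    have "continuous_on {a..b} (\<lambda>x. u a + integral {a..x} h)"
      by (intro continuous_on_add continuous_on_const indefinite_integral_continuous_1 hi) auto
    then show ?thesis by (rule continuous_on_eq) (rule u[symmetric])
  qed
  have \<phi>_cont: "continuous_on A \<phi>" for A
    using DERIV_isCont[OF \<phi>] continuous_at_imp_continuous_on by blast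
  have int1: "(\<lambda>x. \<phi>' x *\<^sub>R u x) integrable_on {c..d}" if "a \<le> c" "d \<le> b" for c d
    by (rule integrable_on_subinterval[of _ "{a..b}"])
      (use that in \<open>auto intro!: integrable_continuous_real continuous_intros u_cont continuous_on_subset[OF \<phi>']\<close>)
  have int2: "(\<lambda>x. \<phi> x *\<^sub>R h x) integrable_on {c..d}" if "a \<le> c" "d \<le> b" for c d
    by (rule integrable_on_subinterval[OF set_lebesgue_integral_eq_integral(1)
          [OF absolutely_integrable_continuous_scaleR[OF h \<phi>_cont]]]) (use that in auto)
  obtain C where C: "C > 0" "\<And>x. x \<in> {a..b} \<Longrightarrow> \<bar>\<phi>' x\<bar> \<le> C"
    using compact_continuous_image[OF continuous_on_subset[OF \<phi>'], of "{a..b}"]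
    by (auto dest!: compact_imp_bounded simp: bounded_pos)
  define F where "F x = \<phi> x *\<^sub>R u x - integral {a..x} (\<lambda>x. \<phi>' x *\<^sub>R u x) - integral {a..x} (\<lambda>x. \<phi> x *\<^sub>R h x)" for x
  define M where "M x = C * x + integral {a..x} (\<lambda>x. norm (h x))" for x
  have incr: "integral {a..y} f - integral {a..x} f = integral {x..y} f"
    if "a \<le> x" "x \<le> y" "y \<le> b" "\<And>c d. a \<le> c \<Longrightarrow> d \<le> b \<Longrightarrow> f integrable_on {c..d}"
    for x y and f :: "real \<Rightarrow> 'w::euclidean_space"
    using Henstock_Kurzweil_Integration.integral_combine[of a x y f] that
    by (simp add: add_diff_eq[symmetric] eq_diff_eq[symmetric] eq_commute add.commute)
  have "F b = F a"
  proof (rule end_points_eq_if_increments_small[OF \<open>a \<le> b\<close>])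
    fix \<epsilon> :: real assume "\<epsilon> > 0"
    have "uniformly_continuous_on {a..b} u" "uniformly_continuous_on {a..b} \<phi>"
      using u_cont \<phi>_cont by (auto intro: compact_uniformly_continuous)
    then obtain d1 d2 where d: "d1 > 0" "d2 > 0"
      "\<And>x y. x \<in> {a..b} \<Longrightarrow> y \<in> {a..b} \<Longrightarrow> dist y x < d1 \<Longrightarrow> dist (u y) (u x) < \<epsilon>"
      "\<And>x y. x \<in> {a..b} \<Longrightarrow> y \<in> {a..b} \<Longrightarrow> dist y x < d2 \<Longrightarrow> dist (\<phi> y) (\<phi> x) < \<epsilon>"
      unfolding uniformly_continuous_on_def using \<open>\<epsilon> > 0\<close> by metis
    show "\<exists>\<delta>>0. \<forall>x y. a \<le> x \<and> x \<le> y \<and> y \<le> b \<and> y - x < \<delta> \<longrightarrow>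
                   norm (F y - F x) \<le> \<epsilon> * (M y - M x)"
    proof (intro exI[of _ "min d1 d2"] conjI allI impI)
      show "0 < min d1 d2" using d by simp
      fix x y assume xy: "a \<le> x \<and> x \<le> y \<and> y \<le> b \<and> y - x < min d1 d2"
      have I1: "integral {x..y} (\<lambda>s. \<phi>' s *\<^sub>R u y) = (\<phi> y - \<phi> x) *\<^sub>R u y"
      proof (rule integral_unique, rule has_integral_scaleR_left)
        show "(\<phi>' has_integral \<phi> y - \<phi> x) {x..y}"
          by (rule fundamental_theorem_of_calculus)
            (use xy \<phi> in \<open>auto simp: has_real_derivative_iff_has_vector_derivative[symmetric]
              intro: has_field_derivative_at_within\<close>)
      qed
      have J1: "(\<lambda>s. \<phi>' s *\<^sub>R u y) integrable_on {x..y}"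
        by (auto intro!: integrable_continuous_real continuous_intros continuous_on_subset[OF \<phi>'])
      have I2: "integral {x..y} (\<lambda>s. \<phi> x *\<^sub>R h s) = \<phi> x *\<^sub>R (u y - u x)"
        using incr[of x y h] xy hi u[of x] u[of y] by simp
      have J2: "(\<lambda>s. \<phi> x *\<^sub>R h s) integrable_on {x..y}"
        using hi[of x y] xy by (intro integrable_cmul) auto
      note J3 = int1[of x y] and J4 = int2[of x y]
      have "F y - F x = ((\<phi> y - \<phi> x) *\<^sub>R u y + \<phi> x *\<^sub>R (u y - u x))
          - (integral {a..y} (\<lambda>x. \<phi>' x *\<^sub>R u x) - integral {a..x} (\<lambda>x. \<phi>' x *\<^sub>R u x))
          - (integral {a..y} (\<lambda>x. \<phi> x *\<^sub>R h x) - integral {a..x} (\<lambda>x. \<phi> x *\<^sub>R h x))"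
        by (simp add: F_def algebra_simps)
      also have "\<dots> = integral {x..y} (\<lambda>s. \<phi>' s *\<^sub>R u y) + integral {x..y} (\<lambda>s. \<phi> x *\<^sub>R h s)
          - integral {x..y} (\<lambda>x. \<phi>' x *\<^sub>R u x) - integral {x..y} (\<lambda>x. \<phi> x *\<^sub>R h x)"
        using xy by (simp only: I1 I2 incr int1 int2)
      also have "\<dots> = integral {x..y} (\<lambda>s. \<phi>' s *\<^sub>R u y - \<phi>' s *\<^sub>R u s)
          + integral {x..y} (\<lambda>s. \<phi> x *\<^sub>R h s - \<phi> s *\<^sub>R h s)"
        using xy J1 J2 J3 J4 by (simp add: Henstock_Kurzweil_Integration.integral_diff)
      finally have F_eq: "F y - F x = integral {x..y} (\<lambda>s. \<phi>' s *\<^sub>R u y - \<phi>' s *\<^sub>R u s)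
          + integral {x..y} (\<lambda>s. \<phi> x *\<^sub>R h s - \<phi> s *\<^sub>R h s)" .
      have "norm (integral {x..y} (\<lambda>s. \<phi>' s *\<^sub>R u y - \<phi>' s *\<^sub>R u s)) \<le> integral {x..y} (\<lambda>s. C * \<epsilon>)"
      proof (rule integral_norm_bound_integral)
        fix s assume s: "s \<in> {x..y}"
        have "\<bar>\<phi>' s\<bar> * norm (u y - u s) \<le> C * \<epsilon>"
          using C(2)[of s] d(3)[of s y] s xy C(1) by (intro mult_mono) (auto simp: dist_norm)
        then show "norm (\<phi>' s *\<^sub>R u y - \<phi>' s *\<^sub>R u s) \<le> C * \<epsilon>"
          by (simp add: scaleR_diff_right[symmetric])
      qed (use J1 J3 xy in \<open>auto intro!: integrable_diff\<close>)
      moreover have "norm (integral {x..y} (\<lambda>s. \<phi> x *\<^sub>R h s - \<phi> s *\<^sub>R h s)) \<le> integral {x..y} (\<lambda>s. \<epsilon> * norm (h s))"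
      proof (rule integral_norm_bound_integral)
        fix s assume s: "s \<in> {x..y}"
        have "\<bar>\<phi> x - \<phi> s\<bar> * norm (h s) \<le> \<epsilon> * norm (h s)"
          using d(4)[of s x] s xy by (intro mult_right_mono) (auto simp: dist_norm)
        then show "norm (\<phi> x *\<^sub>R h s - \<phi> s *\<^sub>R h s) \<le> \<epsilon> * norm (h s)"
          by (simp add: scaleR_diff_left[symmetric])
      next
        show "(\<lambda>s. \<epsilon> * norm (h s)) integrable_on {x..y}"
          using nh[of x y] xy by (auto intro!: integrable_on_mult_right)
      qed (use J2 J4 xy in \<open>auto intro!: integrable_diff\<close>)
      ultimately have "norm (F y - F x) \<le> integral {x..y} (\<lambda>s. C * \<epsilon>) + integral {x..y} (\<lambda>s. \<epsilon> * norm (h s))"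
        unfolding F_eq by (rule norm_triangle_mono)
      also have "\<dots> = \<epsilon> * (M y - M x)"
        using xy incr[of x y "\<lambda>x. norm (h x)"] nh by (simp add: M_def algebra_simps)
      finally show "norm (F y - F x) \<le> \<epsilon> * (M y - M x)" .
    qed
  qed
  then have "\<phi> b *\<^sub>R u b - (integral {a..b} (\<lambda>x. \<phi>' x *\<^sub>R u x) + integral {a..b} (\<lambda>x. \<phi> x *\<^sub>R h x)) = \<phi> a *\<^sub>R u a"
    by (simp add: F_def diff_diff_eq)
  then show ?thesis by (metis add_diff_cancel_left' diff_add_cancel)
qed

lemma test_function_deriv:
  assumes "test_function a b \<phi>"
  shows "(\<phi> has_real_derivative deriv \<phi> x) (at x)" and "continuous_on UNIV (deriv \<phi>)"
proof -
  have d: "(deriv ^^ k) \<phi> differentiable at x" for k x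
    using assms by (simp add: test_function_def)
  from d[of 0 x] show "(\<phi> has_real_derivative deriv \<phi> x) (at x)"
    by (simp add: DERIV_deriv_iff_real_differentiable)
  from d[of 1] show "continuous_on UNIV (deriv \<phi>)"
    by (intro continuous_at_imp_continuous_on) (auto intro: differentiable_imp_continuous_within)
qed

lemma test_function_eq_0:
  assumes "test_function a b \<phi>" "x \<notin> {a<..<b}"
  shows "\<phi> x = 0"
  using assms closure_subset[of "{x. \<phi> x \<noteq> 0}"] unfolding test_function_def by blast

lemma has_weak_derivative_indefinite_integral:
  fixes h :: "real \<Rightarrow> 'v::euclidean_space"
  assumes "a \<le> b" and h: "h absolutely_integrable_on {a..b}"
    and u: "\<And>x. x \<in> {a..b} \<Longrightarrow> u x = u a + integral {a..x} h"
  shows "has_weak_derivative a b u h"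
proof -
  have u_cont: "continuous_on {a..b} u"
  proof -
    have "continuous_on {a..b} (\<lambda>x. u a + integral {a..x} h)"
      by (intro continuous_on_add continuous_on_const indefinite_integral_continuous_1
          set_lebesgue_integral_eq_integral(1)[OF h])
    then show ?thesis by (rule continuous_on_eq) (rule u[symmetric])
  qed
  have "(LINT t:{a<..<b}|lebesgue. deriv \<phi> t *\<^sub>R u t) = - (LINT t:{a<..<b}|lebesgue. \<phi> t *\<^sub>R h t)"
    if "test_function a b \<phi>" for \<phi>
  proof -
    note \<phi> = test_function_deriv[OF that] 
    have c: "continuous_on {a..b} \<phi>"
      using DERIV_isCont[OF \<phi>(1)] continuous_at_imp_continuous_on by blast
    have A: "(\<lambda>t. deriv \<phi> t *\<^sub>R u t) absolutely_integrable_on {a..b}"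
      by (intro absolutely_integrable_continuous_real continuous_intros u_cont continuous_on_subset[OF \<phi>(2)]) simp
    have B: "(\<lambda>t. \<phi> t *\<^sub>R h t) absolutely_integrable_on {a..b}"
      by (rule absolutely_integrable_continuous_scaleR[OF h c])
    have "integral {a..b} (\<lambda>x. deriv \<phi> x *\<^sub>R u x) + integral {a..b} (\<lambda>x. \<phi> x *\<^sub>R h x) = 0"
      using integration_by_parts_indefinite_integral[OF \<open>a \<le> b\<close> h u \<phi>]
        test_function_eq_0[OF that, of a] test_function_eq_0[OF that, of b] by simp
    then have "integral {a<..<b} (\<lambda>x. deriv \<phi> x *\<^sub>R u x) = - integral {a<..<b} (\<lambda>x. \<phi> x *\<^sub>R h x)"
      by (simp add: integral_open_interval_real eq_neg_iff_add_eq_0)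
    moreover have "(LINT t:{a<..<b}|lebesgue. f t) = integral {a<..<b} f"
      if "f absolutely_integrable_on {a..b}" for f :: "real \<Rightarrow> 'v"
      using that by (intro set_lebesgue_integral_eq_integral(2)) (simp add: absolutely_integrable_on_Icc_iff_Ioo)
    ultimately show ?thesis using A B by simp
  qed
  moreover have "u absolutely_integrable_on {a..b}"
    by (rule absolutely_integrable_continuous_real[OF u_cont])
  ultimately show ?thesis
    using h unfolding has_weak_derivative_def by (simp add: absolutely_integrable_on_Icc_iff_Ioo)
qed

section \<open>Absolute continuity and uniqueness of the weak derivative\<close>

text \<open>
  Split \<open>norm (h x)\<close> at a level \<open>N\<close>.  The part above \<open>N\<close> has integral below \<open>\<epsilon> / 2\<close> over
  the whole interval once \<open>N\<close> is large; the part below \<open>N\<close> contributes at most \<open>N\<close> times the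
  total length of the division.
\<close>

lemma absolutely_continuous_indefinite_integral:
  fixes h :: "real \<Rightarrow> 'v::euclidean_space"
  assumes h: "h absolutely_integrable_on {a..b}"
    and u: "\<And>x. x \<in> {a..b} \<Longrightarrow> u x = u a + integral {a..x} h"
  shows "absolutely_continuous_fun a b u"
  unfolding absolutely_continuous_fun_def
proof (intro allI impI)
  fix \<epsilon> :: real assume "\<epsilon> > 0"
  let ?r = "\<lambda>n x. max 0 (norm (h x) - real n)"
  have r_abs: "?r n absolutely_integrable_on {a..b}" for n
    by (intro absolutely_integrable_max_1 set_integral_diff absolutely_integrable_norm[OF h, unfolded o_def])
       (auto simp: absolutely_integrable_on_const)
  have r_int: "?r n integrable_on {c..d}" if "{c..d} \<subseteq> {a..b}" for n c d
    using set_lebesgue_integral_eq_integral(1)[OF r_abs] that by (rule integrable_on_subinterval)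
  have h_int: "h integrable_on {c..d}" if "{c..d} \<subseteq> {a..b}" for c d
    using set_lebesgue_integral_eq_integral(1)[OF h] that by (rule integrable_on_subinterval)
  have nh: "(\<lambda>x. norm (h x)) integrable_on {a..b}" using h by (simp add: absolutely_integrable_on_def)
  have "(\<lambda>n. integral {a..b} (?r n)) \<longlonglongrightarrow> integral {a..b} (\<lambda>x. 0)"
  proof (rule dominated_convergence(2)[OF r_int nh])
    show "(\<lambda>n. ?r n x) \<longlonglongrightarrow> 0" for x
    proof (rule tendsto_eventually)
      obtain N :: nat where "norm (h x) < real N" using reals_Archimedean2 by blast
      then show "\<forall>\<^sub>F n in sequentially. ?r n x = 0"
        by (intro eventually_sequentiallyI[of N]) simp
    qed
  qed auto
  then have "(\<lambda>n. integral {a..b} (?r n)) \<longlonglongrightarrow> 0" by simp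
  then have "\<forall>\<^sub>F n in sequentially. integral {a..b} (?r n) < \<epsilon> / 2"
    using \<open>\<epsilon> > 0\<close> by (intro order_tendstoD(2)) auto
  then obtain N where N: "integral {a..b} (?r N) < \<epsilon> / 2"
    by (auto simp: eventually_sequentially)
  define \<delta> where "\<delta> = \<epsilon> / (2 * (real N + 1))"
  have \<delta>: "\<delta> > 0" "real N * \<delta> \<le> \<epsilon> / 2"
    using \<open>\<epsilon> > 0\<close> by (auto simp: \<delta>_def field_simps)
  show "\<exists>\<delta>>0. \<forall>\<D> S. \<D> division_of S \<and> S \<subseteq> {a..b} \<and> (\<Sum>I\<in>\<D>. Sup I - Inf I) < \<delta> \<longrightarrow>
        (\<Sum>I\<in>\<D>. norm (u (Sup I) - u (Inf I))) < \<epsilon>"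
  proof (intro exI[of _ \<delta>] conjI allI impI; (elim conjE)?)
    fix \<D> :: "real set set" and S
    assume D: "\<D> division_of S" and S: "S \<subseteq> {a..b}" and len: "(\<Sum>I\<in>\<D>. Sup I - Inf I) < \<delta>"
    have I: "\<exists>c d. c \<le> d \<and> I = {c..d} \<and> {c..d} \<subseteq> {a..b}" if ID: "I \<in> \<D>" for I
    proof -
      obtain c d where "I = {c..d}" using division_ofD(4)[OF D ID] by auto
      moreover have "I \<noteq> {}" "I \<subseteq> {a..b}" using division_ofD(2,3)[OF D ID] S by auto
      ultimately show ?thesis by auto
    qed
    have le: "norm (u (Sup I) - u (Inf I)) \<le> integral I (?r N) + real N * (Sup I - Inf I)" if ID: "I \<in> \<D>" for I
    proof -
      obtain c d where cd: "c \<le> d" "I = {c..d}" "{c..d} \<subseteq> {a..b}" using I[OF ID] by blast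
      then have ac: "a \<le> c" "d \<le> b" by auto
      have "integral {a..c} h + integral {c..d} h = integral {a..d} h"
        by (rule Henstock_Kurzweil_Integration.integral_combine) (use cd ac in \<open>auto intro!: h_int\<close>)
      moreover have "u d - u c = (u a + integral {a..d} h) - (u a + integral {a..c} h)"
        by (intro arg_cong2[where f="(-)"] u) (use cd(1) ac in auto)
      ultimately have "u d - u c = integral {c..d} h"
        by (metis add_diff_cancel_left add_diff_cancel_left')
      then have "norm (u d - u c) \<le> integral {c..d} (\<lambda>x. ?r N x + real N)"
        by (auto intro!: integral_norm_bound_integral h_int r_int cd(3) integrable_add)
      also have "\<dots> = integral {c..d} (?r N) + real N * (d - c)"
        using cd by (subst Henstock_Kurzweil_Integration.integral_add) (auto intro!: r_int)
      finally show ?thesis using cd by simp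
    qed
    have rI: "?r N integrable_on I" if ID: "I \<in> \<D>" for I using I[OF ID] r_int by auto
    have "(\<Sum>I\<in>\<D>. norm (u (Sup I) - u (Inf I))) \<le> (\<Sum>I\<in>\<D>. integral I (?r N) + real N * (Sup I - Inf I))"
      by (intro sum_mono le)
    also have "\<dots> = integral S (?r N) + real N * (\<Sum>I\<in>\<D>. Sup I - Inf I)"
      by (simp add: sum.distrib sum_distrib_left integral_combine_division_bottomup[OF D rI])
    also have "\<dots> \<le> integral {a..b} (?r N) + real N * \<delta>"
    proof (intro add_mono mult_left_mono)
      show "integral S (?r N) \<le> integral {a..b} (?r N)"
        by (intro integral_subset_le S r_int integrable_combine_division[OF D rI]) auto
    qed (use len in auto)
    also have "\<dots> < \<epsilon>" using N \<delta>(2) by simp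
    finally show "(\<Sum>I\<in>\<D>. norm (u (Sup I) - u (Inf I))) < \<epsilon>" .
  qed (rule \<delta>(1))
qed

lemma absolutely_continuous_fun_imp_continuous_on:
  fixes u :: "real \<Rightarrow> 'v::euclidean_space"
  assumes "absolutely_continuous_fun a b u"
  shows "continuous_on {a..b} u"
  unfolding continuous_on_iff
proof (intro ballI allI impI)
  fix x e :: real assume x: "x \<in> {a..b}" and "e > 0"
  then obtain \<delta> where "\<delta> > 0" and \<delta>: "\<And>\<D> S. \<D> division_of S \<Longrightarrow> S \<subseteq> {a..b} \<Longrightarrow>
      (\<Sum>I\<in>\<D>. Sup I - Inf I) < \<delta> \<Longrightarrow> (\<Sum>I\<in>\<D>. norm (u (Sup I) - u (Inf I))) < e"
    using assms unfolding absolutely_continuous_fun_def by meson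
  have *: "norm (u d - u c) < e" if "c \<le> d" "{c..d} \<subseteq> {a..b}" "d - c < \<delta>" for c d
  proof -
    have "{{c..d}} division_of {c..d}" using division_of_self[of c d] that(1) by simp
    from \<delta>[OF this that(2)] that show ?thesis by simp
  qed
  have "dist (u y) (u x) < e" if "y \<in> {a..b}" "dist y x < \<delta>" for y
    using *[of x y] *[of y x] x that by (cases "x \<le> y") (auto simp: dist_norm norm_minus_commute)
  then show "\<exists>d>0. \<forall>x'\<in>{a..b}. dist x' x < d \<longrightarrow> dist (u x') (u x) < e"
    using \<open>\<delta> > 0\<close> by blast
qed

text \<open>
  By the Lebesgue differentiation theorem \<open>f x\<close> is, for almost every \<open>x\<close>, the limit of the means
  of \<open>f\<close> over \<open>{x..x + h}\<close>, and these vanish.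
\<close>

lemma negligible_nonzero_if_all_integrals_0:
  fixes f :: "real \<Rightarrow> 'v::euclidean_space"
  assumes f: "f integrable_on {a..b}"
    and zero: "\<And>x y. a \<le> x \<Longrightarrow> x \<le> y \<Longrightarrow> y \<le> b \<Longrightarrow> integral {x..y} f = 0"
  shows "negligible {x \<in> {a..b}. f x \<noteq> 0}"
proof -
  define g where "g x = (if x \<in> {a..b} then f x else 0)" for x
  have "g integrable_on UNIV" using f unfolding g_def by (subst integrable_restrict_UNIV)
  then have "g integrable_on cbox c d" for c d by (rule integrable_on_subcbox) simp
  from integrable_ccontinuous_explicit[OF this]
  obtain N where N: "negligible N"
    "\<And>x e. \<lbrakk>x \<notin> N; 0 < e\<rbrakk> \<Longrightarrow> \<exists>d>0. \<forall>h. 0 < h \<and> h < d \<longrightarrow>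
       norm (integral (cbox x (x + h *\<^sub>R One)) g /\<^sub>R h ^ DIM(real) - g x) < e" by blast
  have "f x = 0" if x: "x \<in> {a..<b}" "x \<notin> N" for x
  proof -
    have "norm (g x) < e" if "e > 0" for e
    proof -
      obtain d where "d > 0" and d: "\<And>h. 0 < h \<Longrightarrow> h < d \<Longrightarrow> norm (integral {x..x + h} g /\<^sub>R h - g x) < e"
        using N(2)[OF x(2) \<open>e > 0\<close>] by auto
      define h where "h = min (d / 2) (b - x)"
      have h: "0 < h" "h < d" "x + h \<le> b" using x \<open>d > 0\<close> by (auto simp: h_def)
      have "integral {x..x + h} g = integral {x..x + h} f"
        by (rule integral_cong) (use x h in \<open>auto simp: g_def\<close>)
      also have "\<dots> = 0" using x h by (intro zero) auto
      finally show ?thesis using d[OF h(1,2)] by simp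
    qed
    then have "g x = 0" by (metis less_irrefl zero_less_norm_iff)
    then show ?thesis using x by (simp add: g_def)
  qed
  then have "{x \<in> {a..b}. f x \<noteq> 0} \<subseteq> N \<union> {b}" by force
  then show ?thesis using N(1) by (meson negligible_Un negligible_sing negligible_subset)
qed

lemma weak_derivative_unique:
  fixes u g h :: "real \<Rightarrow> 'v::euclidean_space"
  assumes g: "has_weak_derivative a b u g" and h: "has_weak_derivative a b u h"
    and cont: "continuous_on {a..b} u"
  shows "negligible {x \<in> {a..b}. g x \<noteq> h x}"
proof -
  have gi: "g integrable_on {a..b}" and hi: "h integrable_on {a..b}"
    using g h by (auto intro: set_lebesgue_integral_eq_integral(1) weak_derivative_absolutely_integrable)
  have "negligible {x \<in> {a..b}. g x - h x \<noteq> 0}"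
  proof (rule negligible_nonzero_if_all_integrals_0)
    show "(\<lambda>x. g x - h x) integrable_on {a..b}" using gi hi by (rule integrable_diff)
    fix x y assume xy: "a \<le> x" "x \<le> y" "y \<le> b"
    have "g integrable_on {x..y}" "h integrable_on {x..y}"
      using xy by (auto intro!: integrable_on_subinterval[OF gi] integrable_on_subinterval[OF hi])
    then show "integral {x..y} (\<lambda>x. g x - h x) = 0"
      using integral_eq_difference_if_weak_derivative_between[OF g cont xy]
        integral_eq_difference_if_weak_derivative_between[OF h cont xy]
      by (simp add: Henstock_Kurzweil_Integration.integral_diff)
  qed
  then show ?thesis by simp
qed

lemma sobolev_W11_weak_deriv:
  fixes u :: "real \<Rightarrow> 'v::euclidean_space"
  assumes "u \<in> sobolev_W11 a b"
  shows "continuous_on {a..b} u"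
    and "has_weak_derivative a b u (weak_deriv a b u)"
    and "weak_deriv a b u absolutely_integrable_on {a..b}"
    and "a \<le> x \<Longrightarrow> x \<le> y \<Longrightarrow> y \<le> b \<Longrightarrow> integral {x..y} (weak_deriv a b u) = u y - u x"
proof -
  show c: "continuous_on {a..b} u"
    using assms absolutely_continuous_fun_imp_continuous_on by (auto simp: sobolev_W11_def)
  show w: "has_weak_derivative a b u (weak_deriv a b u)"
  proof -
    obtain g where "has_weak_derivative a b u g" using assms by (auto simp: sobolev_W11_def)
    then show ?thesis unfolding weak_deriv_def by (rule someI[of "has_weak_derivative a b u"])
  qed
  show "weak_deriv a b u absolutely_integrable_on {a..b}"
    by (rule weak_derivative_absolutely_integrable[OF w])
  show "a \<le> x \<Longrightarrow> x \<le> y \<Longrightarrow> y \<le> b \<Longrightarrow> integral {x..y} (weak_deriv a b u) = u y - u x"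
    by (rule integral_eq_difference_if_weak_derivative_between[OF w c])
qed

text \<open>
  This is how competitors are built: prescribe the derivative and integrate.  The action is
  computed from \<open>weak_deriv\<close>, which is only known up to a negligible set.
\<close>

lemma sobolev_W11_indefinite_integral:
  fixes h :: "real \<Rightarrow> 'v::euclidean_space"
  assumes "a \<le> b" and h: "h absolutely_integrable_on {a..b}"
    and u: "\<And>x. x \<in> {a..b} \<Longrightarrow> u x = u a + integral {a..x} h"
  shows "u \<in> sobolev_W11 a b" and "negligible {x \<in> {a..b}. weak_deriv a b u x \<noteq> h x}"
proof -
  have w: "has_weak_derivative a b u h"
    by (rule has_weak_derivative_indefinite_integral[OF assms])
  then show W: "u \<in> sobolev_W11 a b"
    using absolutely_continuous_indefinite_integral[OF h u] by (auto simp: sobolev_W11_def)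
  show "negligible {x \<in> {a..b}. weak_deriv a b u x \<noteq> h x}"
    by (rule weak_derivative_unique[OF sobolev_W11_weak_deriv(2)[OF W] w sobolev_W11_weak_deriv(1)[OF W]])
qed

section \<open>Competitors that follow a chord\<close>

lemma strict_convexity_SC_imp_subgradient:
  fixes L :: "real \<Rightarrow> 'v::euclidean_space \<Rightarrow> 'v \<Rightarrow> real"
  assumes "strict_convexity_SC a b L" "s \<in> {a..b}"
  shows "\<exists>\<xi>. is_subgradient (L s y) p \<xi>"
proof -
  define R where "R = 1 + \<bar>s\<bar> + norm y + norm p"
  have "R \<ge> 1" "max \<bar>s\<bar> (max (norm y) (norm p)) \<le> R + 1" by (auto simp: R_def)
  then show ?thesis
    using assms unfolding strict_convexity_SC_def by meson
qed

text \<open>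
  Precomposing with the projection of the line onto \<open>{a..b}\<close> extends the Lagrangian continuously
  to all times.
\<close>

lemma lagrangian_borel_measurable:
  fixes L :: "real \<Rightarrow> 'v::euclidean_space \<Rightarrow> 'v \<Rightarrow> real"
  assumes L: "continuous_on ({a..b} \<times> UNIV \<times> UNIV) (\<lambda>(t, y, p). L t y p)"
    and u: "continuous_on {a..b} u" and g: "g absolutely_integrable_on {a..b}"
  shows "(\<lambda>s. L s (u s) (g s)) \<in> borel_measurable (lebesgue_on {a..b})"
proof (cases "a \<le> b")
  case True
  define c where "c s = max a (min b s)" for s :: real
  have c: "c s \<in> {a..b}" "s \<in> {a..b} \<Longrightarrow> c s = s" for s using True by (auto simp: c_def)
  have "continuous_on UNIV (\<lambda>x. (\<lambda>(t, y, p). L t y p) (c (fst x), fst (snd x), snd (snd x)))"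
    unfolding c_def
    by (rule continuous_on_compose2[OF L]) (use True in \<open>auto intro!: continuous_intros\<close>)
  then have Lc: "(\<lambda>x. L (c (fst x)) (fst (snd x)) (snd (snd x))) \<in> borel_measurable borel"
    by (intro borel_measurable_continuous_onI) (simp only: case_prod_conv)
  have "(\<lambda>s. s) \<in> borel_measurable (lebesgue_on {a..b})" "u \<in> borel_measurable (lebesgue_on {a..b})"
    by (auto intro!: continuous_imp_measurable_on_sets_lebesgue u continuous_intros)
  moreover have "g \<in> borel_measurable (lebesgue_on {a..b})"
    using g by (rule absolutely_integrable_imp_borel_measurable) simp
  ultimately have "(\<lambda>s. (s, u s, g s)) \<in> borel_measurable (lebesgue_on {a..b})"
    by (intro borel_measurable_Pair)
  from measurable_compose[OF this Lc]
  have "(\<lambda>s. L (c s) (u s) (g s)) \<in> borel_measurable (lebesgue_on {a..b})" by simp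
  then show ?thesis
    by (rule measurable_cong[THEN iffD1, rotated]) (simp add: c)
qed (simp add: measurable_def space_restrict_space)

text \<open>
  A subgradient at \<open>0\<close> is bounded uniformly: evaluating the subgradient inequality at the unit
  vector in its direction bounds its norm by the oscillation of \<open>L\<close> on a compact set.
\<close>

lemma lagrangian_affine_minorant:
  fixes L :: "real \<Rightarrow> 'v::euclidean_space \<Rightarrow> 'v \<Rightarrow> real"
  assumes L: "continuous_on ({a..b} \<times> UNIV \<times> UNIV) (\<lambda>(t, y, p). L t y p)"
    and SC: "strict_convexity_SC a b L"
  obtains C where "C > 0"
    "\<And>s y q. s \<in> {a..b} \<Longrightarrow> norm y \<le> r \<Longrightarrow> - (C * (1 + norm q)) \<le> L s y q"
proof -
  let ?K = "{a..b} \<times> cball (0::'v) r \<times> cball (0::'v) 1"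
  have "compact ((\<lambda>(t, y, p). L t y p) ` ?K)"
    by (intro compact_continuous_image continuous_on_subset[OF L] compact_Times compact_cball) auto
  then obtain B where B: "B > 0" "\<forall>z\<in>(\<lambda>(t, y, p). L t y p) ` ?K. norm z \<le> B"
    using compact_imp_bounded bounded_pos by metis
  have bd: "\<bar>L s y q\<bar> \<le> B" if "s \<in> {a..b}" "norm y \<le> r" "norm q \<le> 1" for s y q
    using B(2) that by force
  show ?thesis
  proof (rule that[of "2 * B"])
    fix s :: real and y q :: 'v assume s: "s \<in> {a..b}" and y: "norm y \<le> r"
    obtain \<xi> where \<xi>: "\<And>q. L s y q \<ge> L s y 0 + \<xi> \<bullet> q"
      using strict_convexity_SC_imp_subgradient[OF SC s, of y 0] by (auto simp: is_subgradient_def)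
    have "norm \<xi> \<le> 2 * B"
    proof (cases "\<xi> = 0")
      case False
      then have "\<xi> \<bullet> sgn \<xi> = norm \<xi>" by (simp add: sgn_div_norm dot_square_norm power2_eq_square)
      moreover have "norm (sgn \<xi>) \<le> 1" by (simp add: norm_sgn)
      ultimately show ?thesis
        using \<xi>[of "sgn \<xi>"] bd[OF s y, of 0] bd[OF s y, of "sgn \<xi>"] by simp
    qed (use B in simp)
    then have "- (2 * B * norm q) \<le> \<xi> \<bullet> q"
      using Cauchy_Schwarz_ineq2[of \<xi> q] mult_right_mono[of "norm \<xi>" "2 * B" "norm q"] by simp
    then show "- (2 * B * (1 + norm q)) \<le> L s y q"
      using \<xi>[of q] bd[OF s y, of 0] B(1) by (simp add: algebra_simps)
  qed (use B in simp)
qed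

lemma action_eq_integral:
  assumes "(\<lambda>s. L s (u s) (weak_deriv a b u s)) absolutely_integrable_on {a..b}"
  shows "action a b L u = ereal (integral {a..b} (\<lambda>s. L s (u s) (weak_deriv a b u s)))"
proof -
  let ?f = "\<lambda>s. L s (u s) (weak_deriv a b u s)"
  have int: "integrable (lebesgue_on {a..b}) ?f"
    using assms by (simp add: set_integrable_def integrable_restrict_space)
  have eq: "(\<integral>\<^sup>+t\<in>{a..b}. ennreal (f t) \<partial>lebesgue) = (\<integral>\<^sup>+t. ennreal (f t) \<partial>lebesgue_on {a..b})" for f
    by (simp add: nn_integral_restrict_space)
  have fin: "enn2ereal x = ereal (enn2real x)" if "x \<noteq> \<infinity>" for x
    using that by (cases x) auto
  have "integral {a..b} ?f = integral\<^sup>L (lebesgue_on {a..b}) ?f"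
    using assms by (simp add: integral_restrict_space set_lebesgue_integral_eq_integral(2)[symmetric] set_lebesgue_integral_def)
  then show ?thesis
    using int unfolding action_def eq real_integrable_def
    by (simp add: fin real_lebesgue_integral_def[OF int])
qed

text \<open>
  The affine minorant keeps the negative part integrable, so an action below \<open>\<infinity>\<close> forces the positive
  part to be integrable as well.
\<close>

lemma absolutely_integrable_if_action_finite:
  fixes L :: "real \<Rightarrow> 'v::euclidean_space \<Rightarrow> 'v \<Rightarrow> real"
  assumes L: "continuous_on ({a..b} \<times> UNIV \<times> UNIV) (\<lambda>(t, y, p). L t y p)"
    and SC: "strict_convexity_SC a b L"
    and u: "u \<in> sobolev_W11 a b" and fin: "action a b L u < \<infinity>"
  shows "(\<lambda>s. L s (u s) (weak_deriv a b u s)) absolutely_integrable_on {a..b}"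
proof -
  let ?f = "\<lambda>s. L s (u s) (weak_deriv a b u s)" and ?M = "lebesgue_on {a..b}"
  note u_cont = sobolev_W11_weak_deriv(1)[OF u] and g = sobolev_W11_weak_deriv(3)[OF u]
  obtain r where r: "\<And>s. s \<in> {a..b} \<Longrightarrow> norm (u s) \<le> r"
    using compact_imp_bounded[OF compact_continuous_image[OF u_cont compact_Icc]]
    unfolding bounded_iff by blast
  obtain C where C: "C > 0"
    "\<And>s y q. s \<in> {a..b} \<Longrightarrow> norm y \<le> r \<Longrightarrow> - (C * (1 + norm q)) \<le> L s y q"
    using lagrangian_affine_minorant[OF L SC] by blast
  have meas: "?f \<in> borel_measurable ?M" by (rule lagrangian_borel_measurable[OF L u_cont g])
  have eq: "(\<integral>\<^sup>+t\<in>{a..b}. ennreal (f t) \<partial>lebesgue) = (\<integral>\<^sup>+t. ennreal (f t) \<partial>?M)" for f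
    by (simp add: nn_integral_restrict_space)
  have iff: "integrable ?M f \<longleftrightarrow> f absolutely_integrable_on {a..b}" for f :: "real \<Rightarrow> real"
    by (simp add: set_integrable_def integrable_restrict_space)
  have "(\<lambda>s. C * (1 + norm (weak_deriv a b u s))) absolutely_integrable_on {a..b}"
    by (intro set_integrable_mult_right set_integral_add absolutely_integrable_norm[OF g, unfolded o_def])
      (auto simp: absolutely_integrable_on_const)
  then have dom: "integrable ?M (\<lambda>s. C * (1 + norm (weak_deriv a b u s)))"
    by (rule iff[THEN iffD2])
  have "(\<integral>\<^sup>+s. ennreal (- ?f s) \<partial>?M) \<le> (\<integral>\<^sup>+s. ennreal (norm (C * (1 + norm (weak_deriv a b u s)))) \<partial>?M)"
  proof (rule nn_integral_mono, rule ennreal_leI)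
    fix s assume "s \<in> space ?M"
    then have s: "s \<in> {a..b}" by simp
    have "- ?f s \<le> C * (1 + norm (weak_deriv a b u s))"
      using C(2)[OF s r[OF s], of "weak_deriv a b u s"] by linarith
    then show "- ?f s \<le> norm (C * (1 + norm (weak_deriv a b u s)))" by (simp only: real_norm_def)
  qed
  also have "\<dots> < \<infinity>" using dom unfolding integrable_iff_bounded by blast
  finally have neg: "(\<integral>\<^sup>+s. ennreal (- ?f s) \<partial>?M) < \<infinity>" .
  have pos: "(\<integral>\<^sup>+s. ennreal (?f s) \<partial>?M) < \<infinity>"
  proof (rule ccontr)
    assume "\<not> ?thesis"
    then have "(\<integral>\<^sup>+s. ennreal (?f s) \<partial>?M) = \<infinity>" by (simp add: less_top[symmetric])
    then have "action a b L u = \<infinity>" using neg unfolding action_def eq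
      by (cases "\<integral>\<^sup>+s. ennreal (- ?f s) \<partial>?M") auto
    with fin show False by simp
  qed
  have "integrable ?M ?f" using meas pos neg unfolding real_integrable_def by (auto simp: less_top)
  then show ?thesis by (rule iff[THEN iffD1])
qed

text \<open>
  Used twice: for the derivative of the competitor, and for the integrand of its action.
\<close>

lemma absolutely_integrable_splice:
  fixes f g :: "real \<Rightarrow> 'v::euclidean_space"
  assumes f: "f absolutely_integrable_on {a..b}" and g: "g absolutely_integrable_on {\<alpha>..\<beta>}"
    and "a \<le> \<alpha>" "\<beta> \<le> b" and x: "x \<le> b"
  defines "h \<equiv> \<lambda>s. if s \<in> {\<alpha>..\<beta>} then g s else f s"
  shows "h absolutely_integrable_on {a..b}"
    and "integral {a..x} h = integral {a..x} f + integral {\<alpha>..min \<beta> x} (\<lambda>s. g s - f s)"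
proof -
  let ?r = "\<lambda>s. if s \<in> {\<alpha>..\<beta>} then g s - f s else 0"
  have fg: "(\<lambda>s. g s - f s) absolutely_integrable_on {\<alpha>..\<beta>}"
    by (intro set_integral_diff g set_integrable_subset[OF f]) (use assms in auto)
  then have "?r absolutely_integrable_on UNIV"
    by (subst absolutely_integrable_restrict_UNIV)
  then have r: "?r absolutely_integrable_on {a..b}"
    by (rule set_integrable_subset) auto
  have h: "h = (\<lambda>s. f s + ?r s)" by (auto simp: h_def)
  show "h absolutely_integrable_on {a..b}" unfolding h by (intro set_integral_add f r)
  have "f integrable_on {a..x}"
    by (rule integrable_on_subinterval[OF set_lebesgue_integral_eq_integral(1)[OF f]]) (use x in auto)
  moreover have "?r integrable_on {a..x}"
    by (rule integrable_on_subinterval[OF set_lebesgue_integral_eq_integral(1)[OF r]]) (use x in auto)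
  ultimately have "integral {a..x} h = integral {a..x} f + integral {a..x} ?r"
    unfolding h by (rule Henstock_Kurzweil_Integration.integral_add)
  also have "integral {a..x} ?r = integral ({\<alpha>..\<beta>} \<inter> {a..x}) (\<lambda>s. g s - f s)"
    by (rule Henstock_Kurzweil_Integration.integral_restrict_Int)
  also have "{\<alpha>..\<beta>} \<inter> {a..x} = {\<alpha>..min \<beta> x}" using assms by auto
  finally show "integral {a..x} h = integral {a..x} f + integral {\<alpha>..min \<beta> x} (\<lambda>s. g s - f s)" .
qed

text \<open>
  Replacing the derivative of \<open>v\<close> by its mean \<open>P\<close> over \<open>{\<alpha>..\<beta>}\<close> does not change the total increment
  over that interval.  Hence the function obtained by integration follows the chord on
  \<open>{\<alpha>..\<beta>}\<close> and rejoins \<open>v\<close> at \<open>\<beta>\<close>.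
\<close>

lemma chord_splice:
  fixes v :: "real \<Rightarrow> 'v::euclidean_space"
  assumes v: "v \<in> sobolev_W11 a b" and ab: "a \<le> \<alpha>" "\<alpha> < \<beta>" "\<beta> \<le> b"
  defines "P \<equiv> (v \<beta> - v \<alpha>) /\<^sub>R (\<beta> - \<alpha>)"
  obtains u where "u \<in> admissible a b (v a) (v b)"
    "\<And>s. s \<in> {\<alpha>..\<beta>} \<Longrightarrow> u s = v \<alpha> + (s - \<alpha>) *\<^sub>R P"
    "\<And>s. s \<in> {a..b} - {\<alpha>..\<beta>} \<Longrightarrow> u s = v s"
    "negligible {s \<in> {a..b}. weak_deriv a b u s \<noteq> (if s \<in> {\<alpha>..\<beta>} then P else weak_deriv a b v s)}"
proof -
  let ?g = "weak_deriv a b v"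
  note g = sobolev_W11_weak_deriv(3,4)[OF v]
  define h where "h = (\<lambda>s. if s \<in> {\<alpha>..\<beta>} then P else ?g s)"
  define u where "u x = v a + integral {a..x} h" for x
  have P: "(\<lambda>s. P) absolutely_integrable_on {\<alpha>..\<beta>}" by (simp add: absolutely_integrable_on_const)
  have h: "h absolutely_integrable_on {a..b}"
    unfolding h_def by (rule absolutely_integrable_splice(1)[OF g(1) P ab(1,3) order_refl])
  have u_eq: "u x = v x + integral {\<alpha>..min \<beta> x} (\<lambda>s. P - ?g s)" if "x \<in> {a..b}" for x
  proof -
    have "integral {a..x} h = integral {a..x} ?g + integral {\<alpha>..min \<beta> x} (\<lambda>s. P - ?g s)"
      unfolding h_def by (rule absolutely_integrable_splice(2)[OF g(1) P ab(1,3)]) (use that in auto)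
    moreover have "integral {a..x} ?g = v x - v a" using that by (intro g(2)) auto
    ultimately show ?thesis by (simp add: u_def)
  qed
  have corr: "integral {\<alpha>..m} (\<lambda>s. P - ?g s) = (m - \<alpha>) *\<^sub>R P - (v m - v \<alpha>)" if "\<alpha> \<le> m" "m \<le> \<beta>" for m
  proof -
    have "?g integrable_on {\<alpha>..m}"
      using that ab by (intro integrable_on_subinterval[OF set_lebesgue_integral_eq_integral(1)[OF g(1)]]) auto
    then have "integral {\<alpha>..m} (\<lambda>s. P - ?g s) = integral {\<alpha>..m} (\<lambda>s. P) - integral {\<alpha>..m} ?g"
      by (intro Henstock_Kurzweil_Integration.integral_diff) auto
    also have "integral {\<alpha>..m} ?g = v m - v \<alpha>" using that ab by (intro g(2)) auto
    finally show ?thesis using that by simp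
  qed
  have chord: "(\<beta> - \<alpha>) *\<^sub>R P = v \<beta> - v \<alpha>" using ab by (simp add: P_def)
  have on: "u s = v \<alpha> + (s - \<alpha>) *\<^sub>R P" if "s \<in> {\<alpha>..\<beta>}" for s
  proof -
    have "min \<beta> s = s" using that by simp
    then show ?thesis using u_eq[of s] corr[of s] that ab by simp
  qed
  have off: "u s = v s" if s: "s \<in> {a..b}" "s < \<alpha> \<or> \<beta> \<le> s" for s
  proof (cases "s < \<alpha>")
    case True
    then have "{\<alpha>..min \<beta> s} = {}" using ab by auto
    then show ?thesis using u_eq[OF s(1)] by simp
  next
    case False
    then have "min \<beta> s = \<beta>" using s ab by auto
    then show ?thesis using u_eq[OF s(1)] corr[of \<beta>] chord ab by simp
  qed
  have ua: "u a = v a" by (simp add: u_def)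
  have "u x = u a + integral {a..x} h" for x by (simp add: u_def)
  note W = sobolev_W11_indefinite_integral[OF _ h this]
  show ?thesis
  proof (rule that[of u])
    show "u \<in> admissible a b (v a) (v b)" using W(1) ua off[of b] ab by (simp add: admissible_def)
    show "negligible {s \<in> {a..b}. weak_deriv a b u s \<noteq> (if s \<in> {\<alpha>..\<beta>} then P else ?g s)}"
      using W(2) ab unfolding h_def by simp
    show "u s = v s" if "s \<in> {a..b} - {\<alpha>..\<beta>}" for s using off[of s] that by auto
  qed (rule on)
qed

text \<open>
  Comparison with the chord over all of \<open>{a..b}\<close>, whose action is finite, shows that the action
  of \<open>v\<close> is finite.  Only then can the common contribution outside \<open>{\<alpha>..\<beta>}\<close> be
  cancelled in the comparison with the chord over \<open>{\<alpha>..\<beta>}\<close>.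
\<close>

lemma minimizer_chord_comparison:
  fixes L :: "real \<Rightarrow> 'v::euclidean_space \<Rightarrow> 'v \<Rightarrow> real"
  assumes L: "continuous_on ({a..b} \<times> UNIV \<times> UNIV) (\<lambda>(t, y, p). L t y p)"
    and SC: "strict_convexity_SC a b L" and min: "is_minimizer a b L v"
    and ab: "a \<le> \<alpha>" "\<alpha> < \<beta>" "\<beta> \<le> b"
  defines "P \<equiv> (v \<beta> - v \<alpha>) /\<^sub>R (\<beta> - \<alpha>)"
  shows "(\<lambda>s. L s (v s) (weak_deriv a b v s)) absolutely_integrable_on {a..b}"
    and "(\<lambda>s. L s (v \<alpha> + (s - \<alpha>) *\<^sub>R P) P) absolutely_integrable_on {\<alpha>..\<beta>}"
    and "integral {\<alpha>..\<beta>} (\<lambda>s. L s (v s) (weak_deriv a b v s))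
           \<le> integral {\<alpha>..\<beta>} (\<lambda>s. L s (v \<alpha> + (s - \<alpha>) *\<^sub>R P) P)"
proof -
  let ?f = "\<lambda>s. L s (v s) (weak_deriv a b v s)"
  have v: "v \<in> sobolev_W11 a b" using min by (simp add: is_minimizer_def)
  have cint: "(\<lambda>s. L s (y + (s - c) *\<^sub>R q) q) absolutely_integrable_on {c..d}" if "a \<le> c" "d \<le> b" for y q c d
  proof (rule absolutely_integrable_continuous_real)
    have "continuous_on {c..d} (\<lambda>s. (\<lambda>(t, y, p). L t y p) (s, y + (s - c) *\<^sub>R q, q))"
      by (rule continuous_on_compose2[OF L]) (use that in \<open>auto intro!: continuous_intros\<close>)
    then show "continuous_on {c..d} (\<lambda>s. L s (y + (s - c) *\<^sub>R q) q)" by simp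
  qed
  show c: "(\<lambda>s. L s (v \<alpha> + (s - \<alpha>) *\<^sub>R P) P) absolutely_integrable_on {\<alpha>..\<beta>}"
    using ab by (intro cint) auto
  show f: "?f absolutely_integrable_on {a..b}"
  proof -
    define Q where "Q = (v b - v a) /\<^sub>R (b - a)"
    have "a < b" using ab by simp
    obtain u where u: "u \<in> admissible a b (v a) (v b)"
      "\<And>s. s \<in> {a..b} \<Longrightarrow> u s = v a + (s - a) *\<^sub>R Q"
      "\<And>s. s \<in> {a..b} - {a..b} \<Longrightarrow> u s = v s"
      "negligible {s \<in> {a..b}. weak_deriv a b u s \<noteq> (if s \<in> {a..b} then Q else weak_deriv a b v s)}"
      by (rule chord_splice[OF v order_refl \<open>a < b\<close> order_refl, folded Q_def]) (rule that)
    have "(\<lambda>s. L s (u s) (weak_deriv a b u s)) absolutely_integrable_on {a..b}"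
    proof (rule absolutely_integrable_spike[OF cint[OF order_refl order_refl, of "v a" Q] u(4)])
      show "L s (u s) (weak_deriv a b u s) = L s (v a + (s - a) *\<^sub>R Q) Q"
        if "s \<in> {a..b} - {s \<in> {a..b}. weak_deriv a b u s \<noteq> (if s \<in> {a..b} then Q else weak_deriv a b v s)}" for s
        using that u(2)[of s] by auto
    qed
    from action_eq_integral[where L=L and u=u, OF this] have "action a b L u < \<infinity>" by simp
    moreover have "action a b L v \<le> action a b L u"
      using min u(1) by (simp add: is_minimizer_def)
    ultimately show ?thesis
      by (intro absolutely_integrable_if_action_finite[OF L SC v]) (rule le_less_trans)
  qed
  let ?c = "\<lambda>s. L s (v \<alpha> + (s - \<alpha>) *\<^sub>R P) P"
  let ?h = "\<lambda>s. if s \<in> {\<alpha>..\<beta>} then ?c s else ?f s"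
  obtain u where u: "u \<in> admissible a b (v a) (v b)"
    "\<And>s. s \<in> {\<alpha>..\<beta>} \<Longrightarrow> u s = v \<alpha> + (s - \<alpha>) *\<^sub>R P"
    "\<And>s. s \<in> {a..b} - {\<alpha>..\<beta>} \<Longrightarrow> u s = v s"
    "negligible {s \<in> {a..b}. weak_deriv a b u s \<noteq> (if s \<in> {\<alpha>..\<beta>} then P else weak_deriv a b v s)}"
    by (rule chord_splice[OF v ab, folded P_def]) (rule that)
  note h = absolutely_integrable_splice[OF f c ab(1,3) order_refl]
  have eq: "L s (u s) (weak_deriv a b u s) = ?h s"
    if "s \<in> {a..b} - {s \<in> {a..b}. weak_deriv a b u s \<noteq> (if s \<in> {\<alpha>..\<beta>} then P else weak_deriv a b v s)}" for s
    using that u(2,3)[of s] by auto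
  have fu: "(\<lambda>s. L s (u s) (weak_deriv a b u s)) absolutely_integrable_on {a..b}"
    by (rule absolutely_integrable_spike[OF h(1) u(4) eq])
  have "integral {a..b} (\<lambda>s. L s (u s) (weak_deriv a b u s)) = integral {a..b} ?h"
    by (rule integral_spike[OF u(4)]) (use eq in auto)
  also have "\<dots> = integral {a..b} ?f + integral {\<alpha>..\<beta>} (\<lambda>s. ?c s - ?f s)"
    using h(2) ab by (simp add: min_absorb1)
  finally have "action a b L u = ereal (integral {a..b} ?f + integral {\<alpha>..\<beta>} (\<lambda>s. ?c s - ?f s))"
    using action_eq_integral[where L=L and u=u, OF fu] by simp
  moreover have "action a b L v \<le> action a b L u" using min u(1) by (simp add: is_minimizer_def)
  ultimately have "0 \<le> integral {\<alpha>..\<beta>} (\<lambda>s. ?c s - ?f s)"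
    using action_eq_integral[where L=L and u=v, OF f] by simp
  also have "\<dots> = integral {\<alpha>..\<beta>} ?c - integral {\<alpha>..\<beta>} ?f"
    using ab by (intro Henstock_Kurzweil_Integration.integral_diff set_lebesgue_integral_eq_integral(1)[OF c]
        integrable_on_subinterval[OF set_lebesgue_integral_eq_integral(1)[OF f]]) auto
  finally show "integral {\<alpha>..\<beta>} ?f \<le> integral {\<alpha>..\<beta>} ?c" by simp
qed

section \<open>Minimizers stay close to their chords\<close>

text \<open>
  A convex function that exceeds an affine one by \<open>m\<close> on a sphere around \<open>P\<close>, and by at most
  \<open>\<epsilon>\<close> at \<open>P\<close> itself, must exceed it linearly outside the sphere: apply convexity to the point \<open>z\<close>
  where the segment from \<open>P\<close> to \<open>q\<close> crosses the sphere.  Values of \<open>f\<close> are thus controlled far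
  away although they are only compared with those of another function on a bounded set.
\<close>

lemma convex_excess_beyond_ball:
  fixes f :: "'v::euclidean_space \<Rightarrow> real"
  assumes sub: "\<And>p. \<exists>\<xi>. is_subgradient f p \<xi>" and "R > 0" and q: "norm (q - P) \<ge> inverse R"
    and sphere: "\<And>z. norm (z - P) = inverse R \<Longrightarrow> f z \<ge> A + \<xi> \<bullet> (z - P) + m"
    and P: "f P \<le> A + \<epsilon>" and "0 \<le> \<epsilon>" "\<epsilon> \<le> m"
  shows "f q \<ge> A + \<xi> \<bullet> (q - P) + (m - \<epsilon>) * (R * norm (q - P))"
proof -
  define l where "l = inverse (R * norm (q - P))"
  have qP: "0 < norm (q - P)" using q \<open>R > 0\<close> by (meson less_le_trans positive_imp_inverse_positive)
  have "1 \<le> R * norm (q - P)" using q \<open>R > 0\<close> by (simp add: field_simps)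
  then have l: "0 < l" "l \<le> 1" "l * (R * norm (q - P)) = 1"
    using qP \<open>R > 0\<close> by (auto simp: l_def field_simps)
  define z where "z = P + l *\<^sub>R (q - P)"
  have "l * norm (q - P) = inverse R" using qP \<open>R > 0\<close> by (simp add: l_def field_simps)
  then have z: "norm (z - P) = inverse R" using l by (simp add: z_def)
  obtain \<zeta> where \<zeta>: "\<And>x. f x \<ge> f z + \<zeta> \<bullet> (x - z)" using sub[of z] by (auto simp: is_subgradient_def)
  have "l * (\<zeta> \<bullet> (q - z)) + (1 - l) * (\<zeta> \<bullet> (P - z)) = \<zeta> \<bullet> (l *\<^sub>R (q - z) + (1 - l) *\<^sub>R (P - z))"
    by (simp add: inner_add_right)
  also have "l *\<^sub>R (q - z) + (1 - l) *\<^sub>R (P - z) = 0" by (simp add: z_def algebra_simps)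
  finally have "l * (\<zeta> \<bullet> (q - z)) + (1 - l) * (\<zeta> \<bullet> (P - z)) = 0" by simp
  moreover have "l * (f z + \<zeta> \<bullet> (q - z)) \<le> l * f q" using \<zeta>[of q] l by (intro mult_left_mono) auto
  moreover have "(1 - l) * (f z + \<zeta> \<bullet> (P - z)) \<le> (1 - l) * f P" using \<zeta>[of P] l by (intro mult_left_mono) auto
  ultimately have "f z \<le> l * f q + (1 - l) * f P" by (simp add: algebra_simps)
  also have "\<dots> \<le> l * f q + (1 - l) * (A + \<epsilon>)" using P l by (intro add_left_mono mult_left_mono) auto
  finally have "f z \<le> l * f q + (1 - l) * (A + \<epsilon>)" .
  moreover have "f z \<ge> A + l * (\<xi> \<bullet> (q - P)) + m" using sphere[OF z] by (simp add: z_def)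
  moreover have "0 \<le> l * \<epsilon>" using l \<open>0 \<le> \<epsilon>\<close> by simp
  ultimately have "l * (A + \<xi> \<bullet> (q - P)) + (m - \<epsilon>) \<le> l * f q"
    by (simp add: algebra_simps)
  moreover have "(m - \<epsilon>) = l * ((m - \<epsilon>) * (R * norm (q - P)))"
    using l(3) by (simp add: mult.left_commute)
  moreover have "l * (A + \<xi> \<bullet> (q - P) + (m - \<epsilon>) * (R * norm (q - P))) =
      l * (A + \<xi> \<bullet> (q - P)) + l * ((m - \<epsilon>) * (R * norm (q - P)))" by (rule distrib_left)
  ultimately have "l * (A + \<xi> \<bullet> (q - P) + (m - \<epsilon>) * (R * norm (q - P))) \<le> l * f q"
    by linarith
  then show ?thesis using l(1) by simp
qed

text \<open>
  Here \<open>\<xi>\<close> is a subgradient at the base point \<open>(t, y\<^sub>0)\<close> and serves all nearby \<open>(s, y)\<close>, where it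
  need not be a subgradient.  Uniform continuity of \<open>L\<close> transfers its inequality, up to \<open>\<tau> / 4\<close>, only
  for bounded \<open>q\<close>; beyond the sphere of radius \<open>1 / R\<close> around \<open>P\<close> convexity takes
  over.  The gap \<open>2 \<tau>\<close> on that sphere pays for the errors and leaves the growth
  \<open>\<tau> R norm (q - P)\<close>.
\<close>

lemma local_uniform_strict_convexity:
  fixes L :: "real \<Rightarrow> 'v::euclidean_space \<Rightarrow> 'v \<Rightarrow> real"
  assumes L: "continuous_on ({a..b} \<times> UNIV \<times> UNIV) (\<lambda>(t, y, p). L t y p)"
    and SC: "strict_convexity_SC a b L" and t: "t \<in> {a..b}"
    and R: "1 \<le> R" "\<bar>t\<bar> \<le> R" "norm y\<^sub>0 \<le> R" "K \<le> R"
  obtains \<tau> \<delta> where "\<tau> > 0" "\<delta> > 0"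
    "\<And>P. norm P \<le> K \<Longrightarrow> \<exists>\<xi>. \<forall>s y. s \<in> {a..b} \<and> \<bar>s - t\<bar> < \<delta> \<and> norm (y - y\<^sub>0) < \<delta> \<longrightarrow>
        L s y P \<le> L t y\<^sub>0 P + \<tau> / 4 \<and>
        (\<forall>q. L t y\<^sub>0 P + \<xi> \<bullet> (q - P) + \<tau> * (R * norm (q - P)) - 5 / 4 * \<tau> \<le> L s y q)"
proof -
  obtain \<tau> where \<tau>: "\<tau> > 0" and strict: "\<And>s y p. s \<in> {a..b} \<Longrightarrow>
      max \<bar>s\<bar> (max (norm y) (norm p)) \<le> R + 1 \<Longrightarrow>
      \<exists>\<xi>. is_subgradient (L s y) p \<xi> \<and>
        (\<forall>q. norm (q - p) \<ge> inverse R \<longrightarrow> L s y q \<ge> L s y p + \<xi> \<bullet> (q - p) + 2 * \<tau>)"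
    using SC R(1) unfolding strict_convexity_SC_def by meson
  let ?K = "{a..b} \<times> cball y\<^sub>0 1 \<times> cball (0::'v) (K + 1)"
  have "uniformly_continuous_on ?K (\<lambda>(t, y, p). L t y p)"
    by (intro compact_uniformly_continuous continuous_on_subset[OF L] compact_Times compact_cball) auto
  then obtain d where "d > 0" and d: "\<And>x x'. x \<in> ?K \<Longrightarrow> x' \<in> ?K \<Longrightarrow> dist x' x < d \<Longrightarrow>
      dist ((\<lambda>(t, y, p). L t y p) x') ((\<lambda>(t, y, p). L t y p) x) < \<tau> / 4"
    using \<tau> unfolding uniformly_continuous_on_def by (metis zero_less_divide_iff zero_less_numeral)
  define \<delta> where "\<delta> = min 1 (d / 2)"
  have near: "\<bar>L s y q - L t y\<^sub>0 q\<bar> < \<tau> / 4"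
    if "s \<in> {a..b}" "\<bar>s - t\<bar> < \<delta>" "norm (y - y\<^sub>0) < \<delta>" "norm q \<le> K + 1" for s y q
  proof -
    have "dist (s, y, q) (t, y\<^sub>0, q) \<le> dist s t + dist y y\<^sub>0"
      by (simp add: dist_Pair_Pair sqrt_sum_squares_le_sum)
    also have "\<dots> < d" using that by (auto simp: \<delta>_def dist_norm)
    finally have "dist ((\<lambda>(t, y, p). L t y p) (s, y, q)) ((\<lambda>(t, y, p). L t y p) (t, y\<^sub>0, q)) < \<tau> / 4"
      using that t by (intro d) (auto simp: \<delta>_def dist_norm norm_minus_commute)
    then show ?thesis by (simp add: dist_norm)
  qed
  show ?thesis
  proof (rule that[OF \<tau>])
    show "\<delta> > 0" using \<open>d > 0\<close> by (simp add: \<delta>_def)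
    fix P :: 'v assume P: "norm P \<le> K"
    obtain \<xi> where \<xi>: "\<And>q. L t y\<^sub>0 q \<ge> L t y\<^sub>0 P + \<xi> \<bullet> (q - P)"
      "\<And>q. norm (q - P) \<ge> inverse R \<Longrightarrow> L t y\<^sub>0 q \<ge> L t y\<^sub>0 P + \<xi> \<bullet> (q - P) + 2 * \<tau>"
      using strict[OF t, of y\<^sub>0 P] P R by (auto simp: is_subgradient_def)
    show "\<exists>\<xi>. \<forall>s y. s \<in> {a..b} \<and> \<bar>s - t\<bar> < \<delta> \<and> norm (y - y\<^sub>0) < \<delta> \<longrightarrow>
        L s y P \<le> L t y\<^sub>0 P + \<tau> / 4 \<and>
        (\<forall>q. L t y\<^sub>0 P + \<xi> \<bullet> (q - P) + \<tau> * (R * norm (q - P)) - 5 / 4 * \<tau> \<le> L s y q)"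
    proof (intro exI[of _ \<xi>] allI impI conjI; elim conjE)
      fix s y assume s: "s \<in> {a..b}" "\<bar>s - t\<bar> < \<delta>" "norm (y - y\<^sub>0) < \<delta>"
      show up: "L s y P \<le> L t y\<^sub>0 P + \<tau> / 4" using near[OF s, of P] P by linarith
      fix q
      have inv: "inverse R \<le> 1" "R > 0" using R(1) by (auto simp: inverse_le_1_iff)
      have in_ball: "norm z \<le> K + 1" if "norm (z - P) \<le> inverse R" for z
        using norm_triangle_sub[of z P] that P inv by linarith
      show "L t y\<^sub>0 P + \<xi> \<bullet> (q - P) + \<tau> * (R * norm (q - P)) - 5 / 4 * \<tau> \<le> L s y q"
      proof (cases "norm (q - P) \<ge> inverse R")
        case True
        \<comment> \<open>The gap \<open>2 \<tau>\<close> loses \<open>\<tau> / 4\<close> on the sphere and another \<open>\<tau> / 4\<close> at \<open>P\<close>.\<close>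
        have "L t y\<^sub>0 P + \<xi> \<bullet> (q - P) + (7 / 4 * \<tau> - \<tau> / 4) * (R * norm (q - P)) \<le> L s y q"
        proof (rule convex_excess_beyond_ball[OF _ \<open>R > 0\<close> True])
          show "\<exists>\<xi>. is_subgradient (L s y) p \<xi>" for p
            by (rule strict_convexity_SC_imp_subgradient[OF SC s(1)])
          show "L t y\<^sub>0 P + \<xi> \<bullet> (z - P) + 7 / 4 * \<tau> \<le> L s y z" if z: "norm (z - P) = inverse R" for z
          proof -
            have "\<bar>L s y z - L t y\<^sub>0 z\<bar> < \<tau> / 4" using z by (intro near s in_ball) simp
            moreover have "L t y\<^sub>0 z \<ge> L t y\<^sub>0 P + \<xi> \<bullet> (z - P) + 2 * \<tau>" using z by (intro \<xi>(2)) simp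
            ultimately show ?thesis by linarith
          qed
        qed (use up \<tau> in auto)
        moreover have "\<tau> * (R * norm (q - P)) \<le> (7 / 4 * \<tau> - \<tau> / 4) * (R * norm (q - P))"
          using \<tau> inv by (intro mult_right_mono) auto
        ultimately show ?thesis using \<tau> by linarith
      next
        case False
        then have "R * norm (q - P) \<le> 1" using inv by (simp add: field_simps)
        then have "\<tau> * (R * norm (q - P)) \<le> \<tau>" using \<tau> by (simp add: mult_left_le)
        moreover have "\<bar>L s y q - L t y\<^sub>0 q\<bar> < \<tau> / 4" using False by (intro near s in_ball) auto
        ultimately show ?thesis using \<xi>(1)[of q] by linarith
      qed
    qed
  qed
qed

text \<open>
  Integrate the inequality of \<open>local_uniform_strict_convexity\<close> along \<open>v\<close> and compare with the
  chord.  The linear term integrates to \<open>0\<close> and \<open>\<tau>\<close> cancels, so the mean of the distance of the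
  derivative from \<open>P\<close> is at most \<open>3 / (2 R)\<close>, where \<open>R\<close> is arbitrary.
\<close>

lemma minimizer_close_to_chord:
  fixes L :: "real \<Rightarrow> 'v::euclidean_space \<Rightarrow> 'v \<Rightarrow> real"
  assumes L: "continuous_on ({a..b} \<times> UNIV \<times> UNIV) (\<lambda>(t, y, p). L t y p)"
    and SC: "strict_convexity_SC a b L" and min: "is_minimizer a b L v"
    and t: "t \<in> {a<..<b}" and "\<eta> > 0"
  obtains \<delta> where "\<delta> > 0"
    "\<And>\<alpha> \<beta> c. t - \<delta> < \<alpha> \<Longrightarrow> \<alpha> < \<beta> \<Longrightarrow> \<beta> < t + \<delta> \<Longrightarrow> norm (v \<beta> - v \<alpha>) \<le> K * (\<beta> - \<alpha>) \<Longrightarrow> c \<in> {\<alpha>..\<beta>} \<Longrightarrow>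
      norm (v c - v \<alpha> - ((c - \<alpha>) / (\<beta> - \<alpha>)) *\<^sub>R (v \<beta> - v \<alpha>)) \<le> \<eta> * (\<beta> - \<alpha>)"
proof -
  \<comment> \<open>The last entry yields the factor \<open>\<eta>\<close> in the end; the others bring the base point and all
  admissible slopes into the range where strict convexity is uniform.\<close>
  define R where "R = Max {1, \<bar>t\<bar>, norm (v t), K, 2 / \<eta>}"
  have R: "1 \<le> R" "\<bar>t\<bar> \<le> R" "norm (v t) \<le> R" "K \<le> R" "2 / \<eta> \<le> R"
    unfolding R_def by (intro Max_ge; simp)+
  have t': "t \<in> {a..b}" using t by simp
  obtain \<tau> \<delta>\<^sub>1 where \<tau>: "\<tau> > 0" and \<delta>\<^sub>1: "\<delta>\<^sub>1 > 0" and conv: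
    "\<And>P. norm P \<le> K \<Longrightarrow> \<exists>\<xi>. \<forall>s y. s \<in> {a..b} \<and> \<bar>s - t\<bar> < \<delta>\<^sub>1 \<and> norm (y - v t) < \<delta>\<^sub>1 \<longrightarrow>
        L s y P \<le> L t (v t) P + \<tau> / 4 \<and>
        (\<forall>q. L t (v t) P + \<xi> \<bullet> (q - P) + \<tau> * (R * norm (q - P)) - 5 / 4 * \<tau> \<le> L s y q)"
    by (rule local_uniform_strict_convexity[OF L SC t' R(1-4)]) (rule that)
  have v: "v \<in> sobolev_W11 a b" using min by (simp add: is_minimizer_def)
  obtain \<delta>\<^sub>2 where \<delta>\<^sub>2: "\<delta>\<^sub>2 > 0" "\<And>s. s \<in> {a..b} \<Longrightarrow> dist s t < \<delta>\<^sub>2 \<Longrightarrow> dist (v s) (v t) < \<delta>\<^sub>1"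
    using sobolev_W11_weak_deriv(1)[OF v] t' \<delta>\<^sub>1 unfolding continuous_on_iff by metis
  define \<delta> where "\<delta> = Min {\<delta>\<^sub>1, \<delta>\<^sub>2, t - a, b - t}"
  have \<delta>: "\<delta> > 0" "\<delta> \<le> \<delta>\<^sub>1" "\<delta> \<le> \<delta>\<^sub>2" "\<delta> \<le> t - a" "\<delta> \<le> b - t"
    using \<delta>\<^sub>1 \<delta>\<^sub>2(1) t by (auto simp: \<delta>_def)
  let ?g = "weak_deriv a b v"
  note g = sobolev_W11_weak_deriv(3,4)[OF v]
  show ?thesis
  proof (rule that[OF \<delta>(1)])
    fix \<alpha> \<beta> c
    assume ab: "t - \<delta> < \<alpha>" "\<alpha> < \<beta>" "\<beta> < t + \<delta>" and slope: "norm (v \<beta> - v \<alpha>) \<le> K * (\<beta> - \<alpha>)"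
      and c: "c \<in> {\<alpha>..\<beta>}"
    define P where "P = (v \<beta> - v \<alpha>) /\<^sub>R (\<beta> - \<alpha>)"
    have ab': "a \<le> \<alpha>" "\<beta> \<le> b" using ab \<delta> by auto
    have P: "norm P \<le> K" "(\<beta> - \<alpha>) *\<^sub>R P = v \<beta> - v \<alpha>"
    proof -
      have "norm P = norm (v \<beta> - v \<alpha>) / (\<beta> - \<alpha>)"
        using ab(2) by (simp add: P_def divide_inverse mult.commute)
      then show "norm P \<le> K" using slope ab(2) by (simp add: divide_le_eq)
      show "(\<beta> - \<alpha>) *\<^sub>R P = v \<beta> - v \<alpha>" using ab(2) by (simp add: P_def)
    qed
    have s_in: "s \<in> {a..b}" "\<bar>s - t\<bar> < \<delta>\<^sub>1" "norm (v s - v t) < \<delta>\<^sub>1" if "s \<in> {\<alpha>..\<beta>}" for s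
      using that ab ab' \<delta> \<delta>\<^sub>2(2)[of s] by (auto simp: dist_norm)
    have chord_in: "norm (v \<alpha> + (s - \<alpha>) *\<^sub>R P - v t) < \<delta>\<^sub>1" if "s \<in> {\<alpha>..\<beta>}" for s
    proof -
      define l where "l = (s - \<alpha>) / (\<beta> - \<alpha>)"
      have l: "0 \<le> l" "l \<le> 1" using that ab(2) by (auto simp: l_def field_simps)
      have "v \<alpha> \<in> ball (v t) \<delta>\<^sub>1" "v \<beta> \<in> ball (v t) \<delta>\<^sub>1"
        using s_in(3)[of \<alpha>] s_in(3)[of \<beta>] ab(2) by (auto simp: dist_norm norm_minus_commute)
      then have "(1 - l) *\<^sub>R v \<alpha> + l *\<^sub>R v \<beta> \<in> ball (v t) \<delta>\<^sub>1"
        using l convex_ball[of "v t" \<delta>\<^sub>1] by (simp add: convex_alt)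
      moreover have "(s - \<alpha>) *\<^sub>R P = l *\<^sub>R (v \<beta> - v \<alpha>)"
        by (simp add: P_def l_def divide_inverse)
      then have "(1 - l) *\<^sub>R v \<alpha> + l *\<^sub>R v \<beta> = v \<alpha> + (s - \<alpha>) *\<^sub>R P"
        by (simp add: algebra_simps)
      ultimately show ?thesis by (simp add: dist_norm norm_minus_commute)
    qed
    obtain \<xi> where \<xi>: "\<And>s y. s \<in> {a..b} \<Longrightarrow> \<bar>s - t\<bar> < \<delta>\<^sub>1 \<Longrightarrow> norm (y - v t) < \<delta>\<^sub>1 \<Longrightarrow>
        L s y P \<le> L t (v t) P + \<tau> / 4"
      "\<And>s y q. s \<in> {a..b} \<Longrightarrow> \<bar>s - t\<bar> < \<delta>\<^sub>1 \<Longrightarrow> norm (y - v t) < \<delta>\<^sub>1 \<Longrightarrow>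
        L t (v t) P + \<xi> \<bullet> (q - P) + \<tau> * (R * norm (q - P)) - 5 / 4 * \<tau> \<le> L s y q"
      using conv[OF P(1)] by blast
    let ?A = "L t (v t) P"
    let ?f = "\<lambda>s. L s (v s) (?g s)" and ?c = "\<lambda>s. L s (v \<alpha> + (s - \<alpha>) *\<^sub>R P) P"
    note cmp = minimizer_chord_comparison[OF L SC min ab'(1) ab(2) ab'(2), folded P_def]
    have f_int: "?f integrable_on {\<alpha>..\<beta>}"
      by (rule integrable_on_subinterval[OF set_lebesgue_integral_eq_integral(1)[OF cmp(1)]]) (use ab' in auto)
    have gP_abs: "(\<lambda>s. ?g s - P) absolutely_integrable_on {\<alpha>..\<beta>}"
      by (intro set_integral_diff set_integrable_subset[OF g(1)]) (use ab' in \<open>auto simp: absolutely_integrable_on_const\<close>)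
    have gP: "(\<lambda>s. ?g s - P) integrable_on {\<alpha>..d}" and ngP: "(\<lambda>s. norm (?g s - P)) integrable_on {\<alpha>..d}"
      if "d \<le> \<beta>" for d
    proof -
      have "(\<lambda>s. ?g s - P) integrable_on {\<alpha>..\<beta>}" "(\<lambda>s. norm (?g s - P)) integrable_on {\<alpha>..\<beta>}"
        using gP_abs unfolding absolutely_integrable_on_def by auto
      then show "(\<lambda>s. ?g s - P) integrable_on {\<alpha>..d}" "(\<lambda>s. norm (?g s - P)) integrable_on {\<alpha>..d}"
        using that by (auto intro: integrable_on_subinterval)
    qed
    have dev: "integral {\<alpha>..d} (\<lambda>s. ?g s - P) = v d - v \<alpha> - (d - \<alpha>) *\<^sub>R P" if "d \<in> {\<alpha>..\<beta>}" for d
    proof -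
      have "?g integrable_on {\<alpha>..d}"
        by (rule integrable_on_subinterval[OF set_lebesgue_integral_eq_integral(1)[OF g(1)]]) (use that ab' in auto)
      then have "integral {\<alpha>..d} (\<lambda>s. ?g s - P) = integral {\<alpha>..d} ?g - integral {\<alpha>..d} (\<lambda>s. P)"
        by (intro Henstock_Kurzweil_Integration.integral_diff) auto
      also have "integral {\<alpha>..d} ?g = v d - v \<alpha>" by (rule g(2)) (use that ab' in auto)
      finally show ?thesis using that by simp
    qed
    have inner0: "((\<lambda>s. \<xi> \<bullet> (?g s - P)) has_integral 0) {\<alpha>..\<beta>}"
      using has_integral_linear[OF integrable_integral[OF gP[OF order_refl]] bounded_linear_inner_right[of \<xi>]]
        dev[of \<beta>] P(2) ab(2) by (simp add: o_def)
    let ?N = "integral {\<alpha>..\<beta>} (\<lambda>s. norm (?g s - P))"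
    have "((\<lambda>s. (?A - 5 / 4 * \<tau>) + \<xi> \<bullet> (?g s - P) + \<tau> * R * norm (?g s - P)) has_integral
        (\<beta> - \<alpha>) * (?A - 5 / 4 * \<tau>) + 0 + \<tau> * R * ?N) {\<alpha>..\<beta>}"
      using has_integral_const_real[of "?A - 5 / 4 * \<tau>" \<alpha> \<beta>] ab(2)
      by (intro has_integral_add inner0 has_integral_mult_right integrable_integral ngP) auto
    then have "(\<beta> - \<alpha>) * (?A - 5 / 4 * \<tau>) + 0 + \<tau> * R * ?N \<le> integral {\<alpha>..\<beta>} ?f"
    proof (rule has_integral_le[OF _ integrable_integral[OF f_int]])
      show "(?A - 5 / 4 * \<tau>) + \<xi> \<bullet> (?g s - P) + \<tau> * R * norm (?g s - P) \<le> ?f s" if "s \<in> {\<alpha>..\<beta>}" for s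
        using \<xi>(2)[OF s_in[OF that], of "?g s"] by (simp add: mult.assoc)
    qed
    also have "\<dots> \<le> integral {\<alpha>..\<beta>} ?c" by (rule cmp(3))
    also have "\<dots> \<le> integral {\<alpha>..\<beta>} (\<lambda>s. ?A + \<tau> / 4)"
      by (intro integral_le set_lebesgue_integral_eq_integral(1)[OF cmp(2)] \<xi>(1) s_in(1,2) chord_in) auto
    also have "\<dots> = (\<beta> - \<alpha>) * (?A + \<tau> / 4)" using ab(2) by simp
    finally have "(\<beta> - \<alpha>) * (?A - 5 / 4 * \<tau>) + 0 + \<tau> * R * ?N \<le> (\<beta> - \<alpha>) * (?A + \<tau> / 4)" .
    moreover have "(\<beta> - \<alpha>) * (?A + \<tau> / 4) - (\<beta> - \<alpha>) * (?A - 5 / 4 * \<tau>) = \<tau> * (3 / 2 * (\<beta> - \<alpha>))"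
      by (simp add: field_simps)
    ultimately have "\<tau> * (R * ?N) \<le> \<tau> * (3 / 2 * (\<beta> - \<alpha>))" by (simp only: mult.assoc)
    then have RN: "R * ?N \<le> 3 / 2 * (\<beta> - \<alpha>)" using \<tau> by simp
    have N0: "0 \<le> ?N" by (rule integral_nonneg[OF ngP]) auto
    have "2 * ?N \<le> \<eta> * (R * ?N)"
      using mult_right_mono[OF R(5) N0] \<open>\<eta> > 0\<close> by (simp add: field_simps)
    also have "\<dots> \<le> \<eta> * (3 / 2 * (\<beta> - \<alpha>))" using RN \<open>\<eta> > 0\<close> by (intro mult_left_mono) auto
    also have "\<dots> \<le> 2 * (\<eta> * (\<beta> - \<alpha>))" using \<open>\<eta> > 0\<close> ab(2) by simp
    finally have N: "?N \<le> \<eta> * (\<beta> - \<alpha>)" by simp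
    have "norm (v c - v \<alpha> - (c - \<alpha>) *\<^sub>R P) \<le> integral {\<alpha>..c} (\<lambda>s. norm (?g s - P))"
      unfolding dev[OF c, symmetric]
      by (rule integral_norm_bound_integral) (use c in \<open>auto intro: gP ngP\<close>)
    also have "\<dots> \<le> ?N" by (rule integral_subset_le) (use c in \<open>auto intro: ngP\<close>)
    also note N
    also have "(c - \<alpha>) *\<^sub>R P = ((c - \<alpha>) / (\<beta> - \<alpha>)) *\<^sub>R (v \<beta> - v \<alpha>)"
      by (simp add: P_def divide_inverse)
    finally show "norm (v c - v \<alpha> - ((c - \<alpha>) / (\<beta> - \<alpha>)) *\<^sub>R (v \<beta> - v \<alpha>)) \<le> \<eta> * (\<beta> - \<alpha>)" .
  qed
qed

section \<open>One-sided derivatives of minimizers\<close>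

text \<open>
  In the application \<open>f\<close> and \<open>g\<close> are the increments of \<open>v\<close> from \<open>t\<close> to the two sides, in either
  order.  The quantity \<open>s *\<^sub>R f r + r *\<^sub>R g s\<close> is, up to sign and the factor \<open>1 / (r + s)\<close>, the
  deviation at \<open>t\<close> from the chord across \<open>t\<close>.  With \<open>r = norm (g s)\<close> the slope of the chord
  stays bounded, whereas the deviation is of the order of the length of the chord.
\<close>

lemma no_mixed_slopes:
  fixes f g :: "real \<Rightarrow> 'v::real_normed_vector"
  assumes chord: "\<And>K. \<exists>\<delta>>0. \<forall>r s. 0 < r \<and> r < \<delta> \<and> 0 < s \<and> s < \<delta> \<and> norm (f r - g s) \<le> K * (r + s) \<longrightarrow>
        norm (s *\<^sub>R f r + r *\<^sub>R g s) \<le> (r + s)\<^sup>2 / 4"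
    and f: "\<exists>K. \<forall>\<^sub>F r in at_right 0. norm (f r) \<le> K * r"
    and g: "filterlim (\<lambda>s. norm (g s) / s) at_top (at_right 0)"
    and g0: "(g \<longlongrightarrow> 0) (at_right 0)"
  shows False
proof -
  obtain K\<^sub>0 where "\<forall>\<^sub>F r in at_right 0. norm (f r) \<le> K\<^sub>0 * r" using f by blast
  then obtain d where d: "d > 0" "\<And>r. 0 < r \<Longrightarrow> r < d \<Longrightarrow> norm (f r) \<le> K\<^sub>0 * r"
    by (auto simp: eventually_at_right_field)
  define K where "K = \<bar>K\<^sub>0\<bar>"
  have fK: "norm (f r) \<le> K * r" if "0 < r" "r < d" for r
  proof -
    have "K\<^sub>0 * r \<le> K * r" using that by (intro mult_right_mono) (auto simp: K_def)
    with d(2)[OF that] show ?thesis by linarith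
  qed
  have "K \<ge> 0" by (simp add: K_def)
  obtain \<delta> where \<delta>: "\<delta> > 0" "\<And>r s. 0 < r \<Longrightarrow> r < \<delta> \<Longrightarrow> 0 < s \<Longrightarrow> s < \<delta> \<Longrightarrow>
      norm (f r - g s) \<le> (K + 1) * (r + s) \<Longrightarrow> norm (s *\<^sub>R f r + r *\<^sub>R g s) \<le> (r + s)\<^sup>2 / 4"
    using chord[of "K + 1"] by blast
  \<comment> \<open>The factor \<open>4 (K + 1)\<close> ensures both \<open>s \<le> r / 4\<close> and \<open>K s \<le> r / 4\<close> for \<open>r = norm (g s)\<close>.\<close>
  have "\<forall>\<^sub>F s in at_right 0. 4 * (K + 1) \<le> norm (g s) / s"
    using g by (simp add: filterlim_at_top)
  moreover have "\<forall>\<^sub>F s in at_right 0. norm (g s) < min \<delta> d"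
    using tendsto_norm[OF g0] \<delta>(1) d(1) by (intro order_tendstoD(2)) auto
  moreover have "\<forall>\<^sub>F s in at_right 0. 0 < s \<and> s < \<delta>"
    using \<delta>(1) by (auto simp: eventually_at_right_field)
  ultimately have "\<forall>\<^sub>F s in at_right 0. 4 * (K + 1) \<le> norm (g s) / s \<and> norm (g s) < min \<delta> d \<and> 0 < s \<and> s < \<delta>"
    by eventually_elim auto
  then obtain s where s: "4 * (K + 1) \<le> norm (g s) / s" "norm (g s) < min \<delta> d" "0 < s" "s < \<delta>"
    using eventually_happens by fastforce
  define r where "r = norm (g s)"
  have rs: "4 * (K + 1) * s \<le> r" using s(1,3) by (simp add: r_def field_simps)
  moreover have "0 < 4 * (K + 1) * s" using s(3) \<open>K \<ge> 0\<close> by simp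
  ultimately have "r > 0" by linarith
  have fr: "norm (f r) \<le> K * r" using fK[of r] \<open>r > 0\<close> s(2) by (simp add: r_def)
  have Ks: "0 \<le> K * s" using \<open>K \<ge> 0\<close> s(3) by simp
  have "norm (f r - g s) \<le> norm (f r) + r" unfolding r_def by (rule norm_triangle_ineq4)
  also have "\<dots> \<le> (K + 1) * (r + s)" using fr Ks s(3) by (simp add: algebra_simps)
  finally have small: "norm (s *\<^sub>R f r + r *\<^sub>R g s) \<le> (r + s)\<^sup>2 / 4"
    using \<open>r > 0\<close> s by (intro \<delta>(2)) (auto simp: r_def)
  have "r * r = norm (r *\<^sub>R g s)" using \<open>r > 0\<close> by (simp add: r_def)
  also have "\<dots> \<le> norm (s *\<^sub>R f r + r *\<^sub>R g s) + norm (s *\<^sub>R f r)"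
    using norm_triangle_ineq4[of "s *\<^sub>R f r + r *\<^sub>R g s" "s *\<^sub>R f r"] by simp
  also have "norm (s *\<^sub>R f r) \<le> s * (K * r)" using fr s(3) by (simp add: mult_left_mono)
  also have "s * (K * r) \<le> r / 4 * r"
    using rs s(3) \<open>r > 0\<close> by (simp add: mult.assoc[symmetric]) (simp add: algebra_simps)
  finally have "r * r \<le> norm (s *\<^sub>R f r + r *\<^sub>R g s) + r / 4 * r" by simp
  moreover have "(r + s)\<^sup>2 / 4 \<le> (r + r / 4)\<^sup>2 / 4"
    using rs Ks s(3) \<open>r > 0\<close> by (intro divide_right_mono power_mono) (auto simp: algebra_simps)
  \<comment> \<open>The right-hand side is \<open>(25 / 64 + 1 / 4) r\<^sup>2\<close>.\<close>
  ultimately have "r * r \<le> (r + r / 4)\<^sup>2 / 4 + r / 4 * r" using small by linarith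
  then have "r * r \<le> 0" by (simp add: power2_eq_square field_simps)
  then show False using \<open>r > 0\<close> by (simp add: mult_le_0_iff)
qed

text \<open>
  The denominator \<open>c h\<close> is \<open>h\<close> for right and \<open>- h\<close> for left derivatives, so that one statement
  covers both.
\<close>

lemma infinite_slope_imp_norm_quotient_at_top:
  fixes w :: "real \<Rightarrow> real ^ 'n" and D :: ereal
  assumes q: "((\<lambda>h. ereal (w h $ i / c h)) \<longlongrightarrow> D) (at_right 0)"
    and c: "\<And>h. 0 < h \<Longrightarrow> \<bar>c h\<bar> = h" and inf: "\<bar>D\<bar> = \<infinity>"
  shows "filterlim (\<lambda>h. norm (w h) / h) at_top (at_right 0)"
proof -
  have "filterlim (\<lambda>h. w h $ i / c h) at_infinity (at_right 0)"
  proof (cases D)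
    case PInf
    then show ?thesis using q by (auto simp: tendsto_PInfty_eq_at_top intro: filterlim_at_top_imp_at_infinity)
  next
    case MInf
    then have "((\<lambda>h. ereal (- (w h $ i / c h))) \<longlongrightarrow> \<infinity>) (at_right 0)"
      using tendsto_uminus_ereal[OF q] by simp
    then have "filterlim (\<lambda>h. - (w h $ i / c h)) at_top (at_right 0)"
      by (simp only: tendsto_PInfty_eq_at_top)
    then have "filterlim (\<lambda>h. w h $ i / c h) at_bot (at_right 0)"
      by (simp only: filterlim_uminus_at_bot)
    then show ?thesis by (rule filterlim_at_bot_imp_at_infinity)
  qed (use inf in auto)
  then have "filterlim (\<lambda>h. norm (w h $ i / c h)) at_top (at_right 0)"
    by (rule filterlim_at_infinity_imp_norm_at_top)
  then show ?thesis
  proof (rule filterlim_at_top_mono)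
    show "\<forall>\<^sub>F h in at_right 0. norm (w h $ i / c h) \<le> norm (w h) / h"
      using eventually_at_right_less[of 0]
    proof eventually_elim
      case (elim h)
      then show ?case using c[of h] component_le_norm_cart[of "w h" i]
        by (simp add: divide_right_mono)
    qed
  qed
qed

lemma finite_slopes_imp_norm_bounded:
  fixes w :: "real \<Rightarrow> real ^ 'n" and D :: "'n \<Rightarrow> ereal"
  assumes q: "\<And>i. ((\<lambda>h. ereal (w h $ i / c h)) \<longlongrightarrow> D i) (at_right 0)"
    and c: "\<And>h. 0 < h \<Longrightarrow> \<bar>c h\<bar> = h" and fin: "\<And>i. \<bar>D i\<bar> \<noteq> \<infinity>"
  shows "\<exists>K. \<forall>\<^sub>F h in at_right 0. norm (w h) \<le> K * h"
proof -
  have comp: "\<forall>\<^sub>F h in at_right 0. \<bar>w h $ i\<bar> \<le> (\<bar>real_of_ereal (D i)\<bar> + 1) * h" for i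
  proof -
    have "D i = ereal (real_of_ereal (D i))" using fin[of i] by (simp add: ereal_real)
    then have "((\<lambda>h. w h $ i / c h) \<longlongrightarrow> real_of_ereal (D i)) (at_right 0)"
      using q[of i] by (metis lim_ereal)
    then have "((\<lambda>h. \<bar>w h $ i / c h\<bar>) \<longlongrightarrow> \<bar>real_of_ereal (D i)\<bar>) (at_right 0)"
      by (rule tendsto_rabs)
    then have "\<forall>\<^sub>F h in at_right 0. \<bar>w h $ i / c h\<bar> < \<bar>real_of_ereal (D i)\<bar> + 1"
      by (rule order_tendstoD(2)) simp
    with eventually_at_right_less[of 0] show ?thesis
    proof eventually_elim
      case (elim h)
      then show ?case using c[of h] by (simp add: divide_less_eq)
    qed
  qed
  have "\<forall>\<^sub>F h in at_right 0. \<forall>i. \<bar>w h $ i\<bar> \<le> (\<bar>real_of_ereal (D i)\<bar> + 1) * h"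
    using comp by (simp add: eventually_all_finite)
  then have "\<forall>\<^sub>F h in at_right 0. norm (w h) \<le> (\<Sum>i\<in>UNIV. \<bar>real_of_ereal (D i)\<bar> + 1) * h"
  proof eventually_elim
    case (elim h)
    have "norm (w h) \<le> (\<Sum>i\<in>UNIV. \<bar>w h $ i\<bar>)" by (rule norm_le_l1_cart)
    also have "\<dots> \<le> (\<Sum>i\<in>UNIV. (\<bar>real_of_ereal (D i)\<bar> + 1) * h)" using elim by (intro sum_mono) auto
    finally show ?case by (simp only: sum_distrib_right)
  qed
  then show ?thesis by blast
qed

lemma filterlim_offset_at_right_0:
  fixes t :: real
  shows "filterlim (\<lambda>h. t + h) (at_right t) (at_right 0)"
    and "filterlim (\<lambda>h. t - h) (at_left t) (at_right 0)"
  unfolding filterlim_at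
  by (auto intro!: tendsto_eq_intros eventually_at_right_less[THEN eventually_mono])

theorem corollary27:
  fixes a b t :: real
    and L :: "real \<Rightarrow> real ^ 'n \<Rightarrow> real ^ 'n \<Rightarrow> real"
    and v :: "real \<Rightarrow> real ^ 'n"
    and Dminus Dplus :: "'n \<Rightarrow> ereal"
  assumes "continuous_on ({a..b} \<times> UNIV \<times> UNIV) (\<lambda>(t, y, p). L t y p)"
    and "strict_convexity_SC a b L"
    and "is_minimizer a b L v"
    and "t \<in> {a<..<b}"
    and "\<And>i. has_left_derivative (\<lambda>s. v s $ i) (Dminus i) t"
    and "\<And>i. has_right_derivative (\<lambda>s. v s $ i) (Dplus i) t"
  shows "(\<exists>i. \<bar>Dminus i\<bar> = \<infinity>) \<longleftrightarrow> (\<exists>i. \<bar>Dplus i\<bar> = \<infinity>)"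
proof -
  define f where "f r = v (t + r) - v t" for r
  define g where "g s = v (t - s) - v t" for s
  have Df: "((\<lambda>h. ereal (f h $ i / h)) \<longlongrightarrow> Dplus i) (at_right 0)" for i
    using filterlim_compose[OF assms(6)[unfolded has_right_derivative_def] filterlim_offset_at_right_0(1)]
    by (simp add: f_def)
  have Dg: "((\<lambda>h. ereal (g h $ i / - h)) \<longlongrightarrow> Dminus i) (at_right 0)" for i
    using filterlim_compose[OF assms(5)[unfolded has_left_derivative_def] filterlim_offset_at_right_0(2)]
    by (simp add: g_def)
  have "v \<in> sobolev_W11 a b" using assms(3) by (simp add: is_minimizer_def)
  then have "isCont v t"
    using continuous_on_interior[OF sobolev_W11_weak_deriv(1), of v a b t] assms(4) by simp
  then have v_lim: "(v \<longlongrightarrow> v t) (at t)" by (simp add: isCont_def)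
  have "((\<lambda>h. v (t + h) - v t) \<longlongrightarrow> v t - v t) (at_right 0)"
    by (intro tendsto_diff tendsto_const filterlim_compose[OF _ filterlim_offset_at_right_0(1)]
        tendsto_within_subset[OF v_lim]) simp
  then have f0: "(f \<longlongrightarrow> 0) (at_right 0)" by (simp add: f_def[abs_def])
  have "((\<lambda>h. v (t - h) - v t) \<longlongrightarrow> v t - v t) (at_right 0)"
    by (intro tendsto_diff tendsto_const filterlim_compose[OF _ filterlim_offset_at_right_0(2)]
        tendsto_within_subset[OF v_lim]) simp
  then have g0: "(g \<longlongrightarrow> 0) (at_right 0)" by (simp add: g_def[abs_def])
  have chord: "\<exists>\<delta>>0. \<forall>r s. 0 < r \<and> r < \<delta> \<and> 0 < s \<and> s < \<delta> \<and> norm (f r - g s) \<le> K * (r + s) \<longrightarrow>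
      norm (s *\<^sub>R f r + r *\<^sub>R g s) \<le> (r + s)\<^sup>2 / 4" for K
  proof -
    obtain \<delta> where "\<delta> > 0" and \<delta>: "\<And>\<alpha> \<beta> c. t - \<delta> < \<alpha> \<Longrightarrow> \<alpha> < \<beta> \<Longrightarrow> \<beta> < t + \<delta> \<Longrightarrow>
        norm (v \<beta> - v \<alpha>) \<le> K * (\<beta> - \<alpha>) \<Longrightarrow> c \<in> {\<alpha>..\<beta>} \<Longrightarrow>
        norm (v c - v \<alpha> - ((c - \<alpha>) / (\<beta> - \<alpha>)) *\<^sub>R (v \<beta> - v \<alpha>)) \<le> 1 / 4 * (\<beta> - \<alpha>)"
      by (rule minimizer_close_to_chord[OF assms(1-4), of "1 / 4" K]) (simp, rule that)
    show ?thesis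
    proof (intro exI[of _ \<delta>] conjI allI impI; (elim conjE)?)
      fix r s assume rs: "0 < r" "r < \<delta>" "0 < s" "s < \<delta>" and slope: "norm (f r - g s) \<le> K * (r + s)"
      have "norm (v t - v (t - s) - ((t - (t - s)) / ((t + r) - (t - s))) *\<^sub>R (v (t + r) - v (t - s)))
          \<le> 1 / 4 * ((t + r) - (t - s))"
        using rs slope by (intro \<delta>) (auto simp: f_def g_def)
      then have "norm (- g s - (s / (r + s)) *\<^sub>R (f r - g s)) \<le> (r + s) / 4"
        by (simp add: f_def g_def)
      then have "(r + s) * norm (- g s - (s / (r + s)) *\<^sub>R (f r - g s)) \<le> (r + s) * ((r + s) / 4)"
        using rs by (intro mult_left_mono) auto
      moreover have "(r + s) *\<^sub>R (- g s - (s / (r + s)) *\<^sub>R (f r - g s)) = (r + s) *\<^sub>R (- g s) - s *\<^sub>R (f r - g s)"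
        using rs by (simp add: scaleR_right_diff_distrib)
      then have "(r + s) *\<^sub>R (- g s - (s / (r + s)) *\<^sub>R (f r - g s)) = - (s *\<^sub>R f r + r *\<^sub>R g s)"
        by (simp add: algebra_simps)
      then have "norm (s *\<^sub>R f r + r *\<^sub>R g s) = norm ((r + s) *\<^sub>R (- g s - (s / (r + s)) *\<^sub>R (f r - g s)))"
        by (simp only: norm_minus_cancel)
      then have "norm (s *\<^sub>R f r + r *\<^sub>R g s) = (r + s) * norm (- g s - (s / (r + s)) *\<^sub>R (f r - g s))"
        using rs by simp
      ultimately show "norm (s *\<^sub>R f r + r *\<^sub>R g s) \<le> (r + s)\<^sup>2 / 4"
        by (simp only: power2_eq_square times_divide_eq_right)
    qed (rule \<open>\<delta> > 0\<close>)
  qed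
  have chord': "\<exists>\<delta>>0. \<forall>r s. 0 < r \<and> r < \<delta> \<and> 0 < s \<and> s < \<delta> \<and> norm (g r - f s) \<le> K * (r + s) \<longrightarrow>
      norm (s *\<^sub>R g r + r *\<^sub>R f s) \<le> (r + s)\<^sup>2 / 4" for K
  proof -
    obtain \<delta> where "\<delta> > 0" and \<delta>: "\<And>r s. 0 < r \<Longrightarrow> r < \<delta> \<Longrightarrow> 0 < s \<Longrightarrow> s < \<delta> \<Longrightarrow>
        norm (f r - g s) \<le> K * (r + s) \<Longrightarrow> norm (s *\<^sub>R f r + r *\<^sub>R g s) \<le> (r + s)\<^sup>2 / 4"
      using chord[of K] by blast
    show ?thesis
    proof (intro exI[of _ \<delta>] conjI allI impI; (elim conjE)?)
      fix r s assume "0 < r" "r < \<delta>" "0 < s" "s < \<delta>" "norm (g r - f s) \<le> K * (r + s)"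
      then show "norm (s *\<^sub>R g r + r *\<^sub>R f s) \<le> (r + s)\<^sup>2 / 4"
        using \<delta>[of s r] by (simp add: norm_minus_commute add.commute)
    qed (rule \<open>\<delta> > 0\<close>)
  qed
  show ?thesis
  proof
    assume "\<exists>i. \<bar>Dminus i\<bar> = \<infinity>"
    then obtain i where "\<bar>Dminus i\<bar> = \<infinity>" ..
    then have inf: "filterlim (\<lambda>h. norm (g h) / h) at_top (at_right 0)"
      by (rule infinite_slope_imp_norm_quotient_at_top[OF Dg, rotated]) simp
    show "\<exists>i. \<bar>Dplus i\<bar> = \<infinity>"
    proof (rule ccontr)
      assume "\<not> (\<exists>i. \<bar>Dplus i\<bar> = \<infinity>)"
      then have "\<exists>K. \<forall>\<^sub>F h in at_right 0. norm (f h) \<le> K * h"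
        by (intro finite_slopes_imp_norm_bounded[OF Df]) auto
      then show False by (rule no_mixed_slopes[OF chord _ inf g0])
    qed
  next
    assume "\<exists>i. \<bar>Dplus i\<bar> = \<infinity>"
    then obtain i where "\<bar>Dplus i\<bar> = \<infinity>" ..
    then have inf: "filterlim (\<lambda>h. norm (f h) / h) at_top (at_right 0)"
      by (rule infinite_slope_imp_norm_quotient_at_top[OF Df, rotated]) simp
    show "\<exists>i. \<bar>Dminus i\<bar> = \<infinity>"
    proof (rule ccontr)
      assume "\<not> (\<exists>i. \<bar>Dminus i\<bar> = \<infinity>)"
      then have "\<exists>K. \<forall>\<^sub>F h in at_right 0. norm (g h) \<le> K * h"
        by (intro finite_slopes_imp_norm_bounded[OF Dg]) auto
      then show False by (rule no_mixed_slopes[OF chord' _ inf f0])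
    qed
  qed
qed

end
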